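(* Let $(M^5,g,\xi,\eta,\varphi)$ be a $5$-dimensional almost contact metric manifold equipped with a metric connection $\nabla^c$ compatible with the almost contact metric structure. If the torsion of $\nabla^c$ is a) vectorial, then $(M^5,g,\xi,\eta,\varphi)$ is of class $\mathcal{W}_1\oplus\mathcal{W}_2$. b) totally skew-symmetric, then $(M^5,g,\xi,\eta,\varphi)$ is of class $\mathcal{W}_3\oplus\mathcal{W}_4\oplus\mathcal{W}_5\oplus\mathcal{W}_6$. c) traceless cyclic, then $(M^5,g,\xi,\eta,\varphi)$ is of class $\mathcal{W}_2\oplus\mathcal{W}_3\oplus\mathcal{W}_5\oplus\mathcal{W}_6\oplus\mathcal{W}_7\oplus\mathcal{W}_8\oplus\mathcal{W}_9\oplus\mathcal{W}_{10}$.
   Context: Local model. $\mathbb{R}^5$ is Euclidean space with scalar product $\langle\cdot,\cdot\rangle$, an orientation and an oriented orthonormal basis $(e_1,\dots,e_5)$; vectors and $1$-forms are identified via $\langle\cdot,\cdot\rangle$; $\Lambda^k$ is the space of $k$-forms on $\mathbb{R}^5$, $*$ the Hodge operator, $\lrcorner$ the interior product, and $(e_1\wedge e_2)(e_1,e_2)=1$. Put $\xi=e_5$, $\eta$ its dual $1$-form, $\varphi$ the endomorphism with $\varphi(e_1)=-e_2$, $\varphi(e_2)=e_1$, $\varphi(e_3)=-e_4$, $\varphi(e_4)=e_3$, $\varphi(\xi)=0$, and $\Phi(X,Y)=\langle X,\varphi(Y)\rangle$, so $\Phi=e_1\wedge e_2+e_3\wedge e_4$. $U(2)=\{B\in O(5):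 B\xi=\xi,\ B\circ\varphi=\varphi\circ B\}$. Subspaces of forms: $\Lambda^1_1=\mathbb{R}\eta$, $\Lambda^1_2=\{\alpha\in\Lambda^1:\xi\lrcorner\alpha=0\}$; $\Lambda^2_1=\mathbb{R}\Phi$, $\Lambda^2_2=\{\alpha\in\Lambda^2:\Phi\wedge\alpha=0,\ *\alpha=\eta\wedge\alpha\}$, $\Lambda^2_3=\{\alpha\in\Lambda^2:*\alpha=-\eta\wedge\alpha\}$, $\Lambda^2_4=\{\alpha\in\Lambda^2:\eta\wedge\alpha=0\}$; $\Lambda^3_i=*\Lambda^2_i$. Identifying $\mathfrak{so}(5)=\Lambda^2$, $\mathfrak{u}(2)=\Lambda^2_1\oplus\Lambda^2_3$ has orthogonal complement $\mathfrak{m}=\Lambda^2_2\oplus\Lambda^2_4$; $\operatorname{pr}_{\mathfrak m}:\Lambda^2\to\mathfrak{m}$ is the orthogonal projection. $\mathcal{A}=\Lambda^1\otimes\Lambda^2=\{A\in\otimes^3\Lambda^1: A(X,Y,Z)+A(X,Z,Y)=0\}$, where $(\alpha\otimes\beta)(X,Y,Z)=\alpha(X)\beta(Y,Z)$; $\mathcal{A}_3=\{A\in\mathcal{A}: A(X,Y,Z)+A(Y,Z,X)+A(Z,X,Y)=0,\ \sum_iA(e_i,e_i,X)=0\}$; $\mathcal{W}=\Lambda^1\otimes\mathfrak{m}$ and $\operatorname{pr}_{\mathcal W}:\mathcal{A}\to\mathcal{W}$, $\operatorname{pr}_{\mathcal W}(\alpha\otimes\beta)=\alpha\otimes\operatorname{pr}_{\mathfrak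 m}(\beta)$. Put $\theta_1(\alpha)(X,Y,Z)=\alpha(Z)\langle X,Y\rangle-\alpha(Y)\langle X,Z\rangle$ for $\alpha\in\Lambda^1$; $\theta_2(\alpha)=\sum_ie_i\otimes(e_i\lrcorner\alpha)$ for $\alpha\in\Lambda^3$; $\theta_3(\alpha)=3\,\eta\otimes\alpha-\theta_2(\eta\wedge\alpha)$ for $\alpha\in\Lambda^2_1\oplus\Lambda^2_2\oplus\Lambda^2_3$. Then $\mathcal{W}=\mathcal{W}_1\oplus\dots\oplus\mathcal{W}_{10}$ ($U(2)$-irreducible summands) with $\mathcal{W}_1=\theta_1(\Lambda^1_1)$, $\mathcal{W}_2=\operatorname{pr}_{\mathcal W}(\theta_1(\Lambda^1_2))$, $\mathcal{W}_3=\operatorname{pr}_{\mathcal W}(\theta_2(\Lambda^3_1))$, $\mathcal{W}_4=\theta_2(\Lambda^3_2)$, $\mathcal{W}_5=\operatorname{pr}_{\mathcal W}(\theta_2(\Lambda^3_3))$, $\mathcal{W}_6=\operatorname{pr}_{\mathcal W}(\theta_2(\Lambda^3_4))$, $\mathcal{W}_7=\theta_3(\Lambda^2_2)$, $\mathcal{W}_8=\{A\in\mathcal{A}_3:A(X,Y,Z)=A(\varphi X,Y,\varphi Z)+A(\varphi X,\varphi Y,Z)\}$, $\mathcal{W}_9=\{A\in\mathcal{A}_3:A(X,Y,Z)=-A(X,\varphi Y,\varphi Z)\}$, $\mathcal{W}_{10}=\{A\in\mathcal{A}_3:A(X,Y,Z)=-A(\varphi X,Y,\varphi Z)-A(\varphi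 X,\varphi Y,Z)\}$. Manifolds. An almost contact metric $5$-manifold $(M^5,g,\xi,\eta,\varphi)$ is a Riemannian $5$-manifold with a unit vector field $\xi$, its dual $1$-form $\eta$ and an endomorphism $\varphi$ of $TM^5$ with $\varphi(\xi)=0$, $\varphi^2=-\mathrm{Id}+\eta\otimes\xi$, $g(\varphi X,\varphi Y)=g(X,Y)-\eta(X)\eta(Y)$. Its fundamental form is $\Phi(X,Y)=g(X,\varphi(Y))$. Locally there are adapted frames: oriented orthonormal frames $(e_1,\dots,e_5)$ with $\xi=e_5$, $\Phi=e_1\wedge e_2+e_3\wedge e_4$, which identify each tangent space with the local model (all subspaces above are $U(2)$-invariant, hence define subbundles). With $\nabla^g$ the Levi-Civita connection and $\omega^g_{ij}=g(\nabla^ge_i,e_j)$, put $\Omega^g(X)=\sum_{i<j}\omega^g_{ij}(X)\,e_i\wedge e_j$. The intrinsic torsion is $\Gamma=\operatorname{pr}_{\mathfrak m}(\Omega^g)$, a section of $\mathcal{W}$. The manifold is of class $\mathcal{W}_{i_1}\oplus\dots\oplus\mathcal{W}_{i_k}$ if $\Gamma\in\mathcal{W}_{i_1}\oplus\dots\oplus\mathcal{W}_{i_k}$. Connections. A metric connection $\nabla$ has torsion $T(X,Y,Z)=g(\nabla_XY-\nabla_YX-[X,Y],Z)$. $T$ is vectorial if there is a $1$-form $\alpha$ with $T(X,Y,Z)=\alpha(X)g(Y,Z)-\alpha(Y)g(X,Z)$; totally skew-symmetric if $T(X,Y,Z)+T(X,Z,Y)=0$; traceless cyclic if $T(X,Y,Z)+T(Y,Z,X)+T(Z,X,Y)=0$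 and $\sum_iT(X,e_i,e_i)=0$. $\nabla$ is compatible with the almost contact metric structure if $\nabla\xi=0$, $\nabla\eta=0$, $\nabla\varphi=0$. *)

theory Defs
  imports
    "HOL-Analysis.Analysis"
    "HOL-Library.Function_Algebras"
    "HOL-Library.Set_Algebras"
begin

section \<open>The local model\<close>

text \<open>
  Forms and tensors on Euclidean 5-space are curried functions. Addition of functions is pointwise
  and addition of sets is elementwise, so \<open>U + V\<close> is the sum of two subspaces of
  forms or tensors.

  In the index type \<open>5\<close> the numerals 1, ..., 5 name the five elements (with \<open>5 = 0\<close>),
  and the order on this type is 5 < 1 < 2 < 3 < 4. The sums over \<open>i < j\<close> below
  have summands that are symmetric in \<open>i, j\<close>, so they do not depend on the chosen order.
\<close>

type_synonym vec5 = "real^5"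
type_synonym form1 = "vec5 \<Rightarrow> real"
type_synonym form2 = "vec5 \<Rightarrow> vec5 \<Rightarrow> real"
type_synonym form3 = "vec5 \<Rightarrow> vec5 \<Rightarrow> vec5 \<Rightarrow> real"

abbreviation bvec :: "5 \<Rightarrow> vec5" where
  "bvec i \<equiv> axis i 1"

abbreviation flat :: "vec5 \<Rightarrow> form1" where
  "flat v \<equiv> (\<lambda>X. v \<bullet> X)"

definition alt1 :: "form1 set" where
  "alt1 = {\<alpha>. linear \<alpha>}"

definition alt2 :: "form2 set" where
  "alt2 = {\<alpha>. bilinear \<alpha> \<and> (\<forall>X Y. \<alpha> X Y = - \<alpha> Y X)}"

definition trilinear :: "form3 \<Rightarrow> bool" where
  "trilinear A \<longleftrightarrow>
     (\<forall>Y Z. linear (\<lambda>X. A X Y Z)) \<and> (\<forall>X Z. linear (\<lambda>Y. A X Y Z)) \<and> (\<forall>X Y. linear (\<lambda>Z. A X Y Z))"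

text \<open>Wedge products, normalised by \<open>(e\<^sub>1 \<and> e\<^sub>2)(e\<^sub>1, e\<^sub>2) = 1\<close>.\<close>

definition wedge11 :: "('v \<Rightarrow> real) \<Rightarrow> ('v \<Rightarrow> real) \<Rightarrow> 'v \<Rightarrow> 'v \<Rightarrow> real" where
  "wedge11 \<alpha> \<beta> X Y = \<alpha> X * \<beta> Y - \<alpha> Y * \<beta> X"

definition wedge12 :: "form1 \<Rightarrow> form2 \<Rightarrow> form3" where
  "wedge12 \<alpha> \<beta> X Y Z = \<alpha> X * \<beta> Y Z + \<alpha> Y * \<beta> Z X + \<alpha> Z * \<beta> X Y"

definition wedge22 :: "form2 \<Rightarrow> form2 \<Rightarrow> vec5 \<Rightarrow> vec5 \<Rightarrow> vec5 \<Rightarrow> vec5 \<Rightarrow> real" where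
  "wedge22 \<alpha> \<beta> X Y Z V =
     \<alpha> X Y * \<beta> Z V - \<alpha> X Z * \<beta> Y V + \<alpha> X V * \<beta> Y Z +
     \<alpha> Y Z * \<beta> X V - \<alpha> Y V * \<beta> X Z + \<alpha> Z V * \<beta> X Y"

definition vol :: "vec5 \<Rightarrow> vec5 \<Rightarrow> vec5 \<Rightarrow> vec5 \<Rightarrow> vec5 \<Rightarrow> real" where
  "vol V1 V2 V3 V4 V5 =
     det ((\<chi> i. if i = 1 then V1 else if i = 2 then V2 else if i = 3 then V3
                else if i = 4 then V4 else V5) :: real^5^5)"

text \<open>The Hodge operator on 2-forms:
  \<open>*(e\<^sub>i \<and> e\<^sub>j) = vol(e\<^sub>i, e\<^sub>j, \<cdot>, \<cdot>, \<cdot>)\<close>, extended linearly.\<close>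

definition hodge :: "form2 \<Rightarrow> form3" where
  "hodge \<alpha> X Y Z =
     (\<Sum>(i, j)\<in>{(i, j). i < j}. \<alpha> (bvec i) (bvec j) * vol (bvec i) (bvec j) X Y Z)"

definition inner2 :: "form2 \<Rightarrow> form2 \<Rightarrow> real" where
  "inner2 \<alpha> \<beta> = (\<Sum>(i, j)\<in>{(i, j). i < j}. \<alpha> (bvec i) (bvec j) * \<beta> (bvec i) (bvec j))"

abbreviation xi0 :: vec5 where
  "xi0 \<equiv> bvec 5"

abbreviation eta0 :: form1 where
  "eta0 \<equiv> flat xi0"

definition phi0 :: "vec5 \<Rightarrow> vec5" where
  "phi0 X = X$2 *\<^sub>R bvec 1 - X$1 *\<^sub>R bvec 2 + X$4 *\<^sub>R bvec 3 - X$3 *\<^sub>R bvec 4"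

definition Phi0 :: form2 where
  "Phi0 X Y = X \<bullet> phi0 Y"

definition Lam11 :: "form1 set" where
  "Lam11 = range (\<lambda>c X. c * eta0 X)"

definition Lam12 :: "form1 set" where
  "Lam12 = {\<alpha> \<in> alt1. \<alpha> xi0 = 0}"

definition Lam21 :: "form2 set" where
  "Lam21 = range (\<lambda>c X Y. c * Phi0 X Y)"

definition Lam22 :: "form2 set" where
  "Lam22 = {\<alpha> \<in> alt2. wedge22 Phi0 \<alpha> = 0 \<and> hodge \<alpha> = wedge12 eta0 \<alpha>}"

definition Lam23 :: "form2 set" where
  "Lam23 = {\<alpha> \<in> alt2. hodge \<alpha> = - wedge12 eta0 \<alpha>}"

definition Lam24 :: "form2 set" where
  "Lam24 = {\<alpha> \<in> alt2. wedge12 eta0 \<alpha> = 0}"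

definition Lam31 :: "form3 set" where "Lam31 = hodge ` Lam21"
definition Lam32 :: "form3 set" where "Lam32 = hodge ` Lam22"
definition Lam33 :: "form3 set" where "Lam33 = hodge ` Lam23"
definition Lam34 :: "form3 set" where "Lam34 = hodge ` Lam24"

definition m_space :: "form2 set" where
  "m_space = Lam22 + Lam24"

definition pr_m :: "form2 \<Rightarrow> form2" where
  "pr_m \<beta> = (THE \<gamma>. \<gamma> \<in> m_space \<and> (\<forall>\<delta>\<in>m_space. inner2 (\<beta> - \<gamma>) \<delta> = 0))"

definition Aspace :: "form3 set" where
  "Aspace = {A. trilinear A \<and> (\<forall>X Y Z. A X Y Z + A X Z Y = 0)}"

definition A3 :: "form3 set" where
  "A3 = {A \<in> Aspace. (\<forall>X Y Z. A X Y Z + A Y Z X + A Z X Y = 0) \<and>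
                     (\<forall>X. (\<Sum>i\<in>UNIV. A (bvec i) (bvec i) X) = 0)}"

text \<open>The linear extension of \<open>\<alpha> \<otimes> \<beta> \<mapsto> \<alpha> \<otimes> pr_m \<beta>\<close>.\<close>

definition pr_W :: "form3 \<Rightarrow> form3" where
  "pr_W A = (\<lambda>X. pr_m (A X))"

definition theta1 :: "form1 \<Rightarrow> form3" where
  "theta1 \<alpha> X Y Z = \<alpha> Z * (X \<bullet> Y) - \<alpha> Y * (X \<bullet> Z)"

definition theta2 :: "form3 \<Rightarrow> form3" where
  "theta2 \<alpha> X Y Z = (\<Sum>i\<in>UNIV. flat (bvec i) X * \<alpha> (bvec i) Y Z)"

definition theta3 :: "form2 \<Rightarrow> form3" where
  "theta3 \<alpha> X Y Z = 3 * (eta0 X * \<alpha> Y Z) - theta2 (wedge12 eta0 \<alpha>) X Y Z"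

definition W1 :: "form3 set" where "W1 = theta1 ` Lam11"
definition W2 :: "form3 set" where "W2 = pr_W ` theta1 ` Lam12"
definition W3 :: "form3 set" where "W3 = pr_W ` theta2 ` Lam31"
definition W4 :: "form3 set" where "W4 = theta2 ` Lam32"
definition W5 :: "form3 set" where "W5 = pr_W ` theta2 ` Lam33"
definition W6 :: "form3 set" where "W6 = pr_W ` theta2 ` Lam34"
definition W7 :: "form3 set" where "W7 = theta3 ` Lam22"

definition W8 :: "form3 set" where
  "W8 = {A \<in> A3. \<forall>X Y Z. A X Y Z = A (phi0 X) Y (phi0 Z) + A (phi0 X) (phi0 Y) Z}"

definition W9 :: "form3 set" where
  "W9 = {A \<in> A3. \<forall>X Y Z. A X Y Z = - A X (phi0 Y) (phi0 Z)}"

definition W10 :: "form3 set" where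
  "W10 = {A \<in> A3. \<forall>X Y Z. A X Y Z = - A (phi0 X) Y (phi0 Z) - A (phi0 X) (phi0 Y) Z}"


section \<open>Smooth 5-manifolds\<close>

text \<open>\<open>k\<close> times continuously differentiable on an open set.\<close>

fun Ck_on :: "nat \<Rightarrow> vec5 set \<Rightarrow> (vec5 \<Rightarrow> 'b::real_normed_vector) \<Rightarrow> bool" where
  "Ck_on 0 S f \<longleftrightarrow> continuous_on S f"
| "Ck_on (Suc k) S f \<longleftrightarrow>
     f differentiable_on S \<and> (\<forall>v. Ck_on k S (\<lambda>x. frechet_derivative f (at x) v))"

definition smooth_on :: "vec5 set \<Rightarrow> (vec5 \<Rightarrow> 'b::real_normed_vector) \<Rightarrow> bool" where
  "smooth_on S f \<longleftrightarrow> (\<forall>k. Ck_on k S f)"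

type_synonym 'a chart = "'a set \<times> ('a \<Rightarrow> vec5)"

text \<open>The manifold is the union of the domains of its charts.\<close>

definition points :: "'a chart set \<Rightarrow> 'a set" where
  "points M = (\<Union>c\<in>M. fst c)"

definition smooth_manifold ::
    "'a::{t2_space, second_countable_topology} chart set \<Rightarrow> bool" where
  "smooth_manifold M \<longleftrightarrow>
     (\<forall>(U, x)\<in>M. open U \<and> open (x ` U) \<and> homeomorphism U (x ` U) x (inv_into U x)) \<and>
     (\<forall>(U, x)\<in>M. \<forall>(V, y)\<in>M. smooth_on (x ` (U \<inter> V)) (y \<circ> inv_into U x))"

definition smooth_fun :: "'a::topological_space chart set \<Rightarrow> 'a set \<Rightarrow> ('a \<Rightarrow> real) \<Rightarrow> bool" where
  "smooth_fun M U f \<longleftrightarrow> (\<forall>(V, x)\<in>M. smooth_on (x ` (U \<inter> V)) (f \<circ> inv_into V x))"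

definition open_in :: "'a::topological_space chart set \<Rightarrow> 'a set \<Rightarrow> bool" where
  "open_in M U \<longleftrightarrow> open U \<and> U \<subseteq> points M"

definition smooth_near :: "'a::topological_space chart set \<Rightarrow> 'a \<Rightarrow> ('a \<Rightarrow> real) \<Rightarrow> bool" where
  "smooth_near M p f \<longleftrightarrow> (\<exists>U. open_in M U \<and> p \<in> U \<and> smooth_fun M U f)"

text \<open>
  Tangent vectors are derivations on germs of smooth functions. Germs are represented by
  total functions; the last clause (value 0 where a function is not smooth near \<open>p\<close>) only makes
  the representation of a tangent vector unique.
\<close>

type_synonym 'a tvec = "('a \<Rightarrow> real) \<Rightarrow> real"
type_synonym 'a field = "'a \<Rightarrow> 'a tvec"

definition tscale :: "real \<Rightarrow> 'a tvec \<Rightarrow> 'a tvec" where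
  "tscale a v = (\<lambda>f. a * v f)"

definition tangent_space :: "'a::topological_space chart set \<Rightarrow> 'a \<Rightarrow> 'a tvec set" where
  "tangent_space M p = {v.
     (\<forall>f h a b. smooth_near M p f \<and> smooth_near M p h \<longrightarrow>
        v (\<lambda>q. a * f q + b * h q) = a * v f + b * v h) \<and>
     (\<forall>f h. smooth_near M p f \<and> smooth_near M p h \<longrightarrow>
        v (\<lambda>q. f q * h q) = f p * v h + h p * v f) \<and>
     (\<forall>f h U. smooth_near M p f \<and> open_in M U \<and> p \<in> U \<and> (\<forall>q\<in>U. f q = h q) \<longrightarrow> v f = v h) \<and>
     (\<forall>f. \<not> smooth_near M p f \<longrightarrow> v f = 0)}"

definition smooth_field :: "'a::topological_space chart set \<Rightarrow> 'a set \<Rightarrow> 'a field \<Rightarrow> bool" where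
  "smooth_field M U X \<longleftrightarrow>
     (\<forall>p\<in>U. X p \<in> tangent_space M p) \<and>
     (\<forall>V f. open_in M V \<and> V \<subseteq> U \<and> smooth_fun M V f \<longrightarrow> smooth_fun M V (\<lambda>q. X q f))"

definition field_near :: "'a::topological_space chart set \<Rightarrow> 'a \<Rightarrow> 'a field \<Rightarrow> bool" where
  "field_near M p X \<longleftrightarrow> (\<exists>U. open_in M U \<and> p \<in> U \<and> smooth_field M U X)"

definition lie_bracket ::
    "'a::topological_space chart set \<Rightarrow> 'a \<Rightarrow> 'a field \<Rightarrow> 'a field \<Rightarrow> 'a tvec" where
  "lie_bracket M p X Y =
     (\<lambda>f. if smooth_near M p f then X p (\<lambda>q. Y q f) - Y p (\<lambda>q. X q f) else 0)"

definition one_form ::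
    "'a::topological_space chart set \<Rightarrow> ('a \<Rightarrow> 'a tvec \<Rightarrow> real) \<Rightarrow> bool" where
  "one_form M \<alpha> \<longleftrightarrow>
     (\<forall>p\<in>points M. \<forall>u\<in>tangent_space M p. \<forall>v\<in>tangent_space M p. \<forall>a b.
        \<alpha> p (tscale a u + tscale b v) = a * \<alpha> p u + b * \<alpha> p v) \<and>
     (\<forall>U X. open_in M U \<and> smooth_field M U X \<longrightarrow> smooth_fun M U (\<lambda>q. \<alpha> q (X q)))"

definition endomorphism_field ::
    "'a::topological_space chart set \<Rightarrow> ('a \<Rightarrow> 'a tvec \<Rightarrow> 'a tvec) \<Rightarrow> bool" where
  "endomorphism_field M \<phi> \<longleftrightarrow>
     (\<forall>p\<in>points M. \<forall>v\<in>tangent_space M p. \<phi> p v \<in> tangent_space M p) \<and>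
     (\<forall>p\<in>points M. \<forall>u\<in>tangent_space M p. \<forall>v\<in>tangent_space M p. \<forall>a b.
        \<phi> p (tscale a u + tscale b v) = tscale a (\<phi> p u) + tscale b (\<phi> p v)) \<and>
     (\<forall>U X. open_in M U \<and> smooth_field M U X \<longrightarrow> smooth_field M U (\<lambda>q. \<phi> q (X q)))"

type_synonym 'a metric_field = "'a \<Rightarrow> 'a tvec \<Rightarrow> 'a tvec \<Rightarrow> real"

definition riemannian_metric ::
    "'a::topological_space chart set \<Rightarrow> 'a metric_field \<Rightarrow> bool" where
  "riemannian_metric M g \<longleftrightarrow>
     (\<forall>p\<in>points M. \<forall>u\<in>tangent_space M p. \<forall>v\<in>tangent_space M p. \<forall>w\<in>tangent_space M p. \<forall>a b.
        g p (tscale a u + tscale b v) w = a * g p u w + b * g p v w) \<and>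
     (\<forall>p\<in>points M. \<forall>u\<in>tangent_space M p. \<forall>v\<in>tangent_space M p. g p u v = g p v u) \<and>
     (\<forall>p\<in>points M. \<forall>v\<in>tangent_space M p. v \<noteq> 0 \<longrightarrow> g p v v > 0) \<and>
     (\<forall>U X Y. open_in M U \<and> smooth_field M U X \<and> smooth_field M U Y \<longrightarrow>
        smooth_fun M U (\<lambda>q. g q (X q) (Y q)))"


section \<open>Almost contact metric structures\<close>

definition almost_contact_metric ::
    "'a::{t2_space, second_countable_topology} chart set \<Rightarrow> 'a metric_field \<Rightarrow> 'a field \<Rightarrow>
     ('a \<Rightarrow> 'a tvec \<Rightarrow> real) \<Rightarrow> ('a \<Rightarrow> 'a tvec \<Rightarrow> 'a tvec) \<Rightarrow> bool" where
  "almost_contact_metric M g \<xi> \<eta> \<phi> \<longleftrightarrow>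
     smooth_manifold M \<and> riemannian_metric M g \<and>
     smooth_field M (points M) \<xi> \<and> one_form M \<eta> \<and> endomorphism_field M \<phi> \<and>
     (\<forall>p\<in>points M. g p (\<xi> p) (\<xi> p) = 1) \<and>
     (\<forall>p\<in>points M. \<forall>v\<in>tangent_space M p. \<eta> p v = g p (\<xi> p) v) \<and>
     (\<forall>p\<in>points M. \<phi> p (\<xi> p) = 0) \<and>
     (\<forall>p\<in>points M. \<forall>v\<in>tangent_space M p. \<phi> p (\<phi> p v) = - v + tscale (\<eta> p v) (\<xi> p)) \<and>
     (\<forall>p\<in>points M. \<forall>u\<in>tangent_space M p. \<forall>v\<in>tangent_space M p.
        g p (\<phi> p u) (\<phi> p v) = g p u v - \<eta> p u * \<eta> p v)"

definition fundamental_form ::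
    "'a metric_field \<Rightarrow> ('a \<Rightarrow> 'a tvec \<Rightarrow> 'a tvec) \<Rightarrow> 'a \<Rightarrow> 'a tvec \<Rightarrow> 'a tvec \<Rightarrow> real" where
  "fundamental_form g \<phi> p u v = g p u (\<phi> p v)"

definition orthonormal_frame ::
    "'a::topological_space chart set \<Rightarrow> 'a metric_field \<Rightarrow> 'a set \<Rightarrow> (5 \<Rightarrow> 'a field) \<Rightarrow> bool" where
  "orthonormal_frame M g U E \<longleftrightarrow>
     (\<forall>i. smooth_field M U (E i)) \<and>
     (\<forall>q\<in>U. \<forall>i j. g q (E i q) (E j q) = (if i = j then 1 else 0))"

text \<open>
  The orientation is the one determined by the structure, i.e. by the volume form
  \<open>\<eta> \<and> \<Phi> \<and> \<Phi>\<close>; every frame with the properties below is oriented.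
\<close>

definition adapted_frame ::
    "'a::topological_space chart set \<Rightarrow> 'a metric_field \<Rightarrow> 'a field \<Rightarrow>
     ('a \<Rightarrow> 'a tvec \<Rightarrow> 'a tvec) \<Rightarrow> 'a set \<Rightarrow> (5 \<Rightarrow> 'a field) \<Rightarrow> bool" where
  "adapted_frame M g \<xi> \<phi> U E \<longleftrightarrow>
     orthonormal_frame M g U E \<and>
     (\<forall>q\<in>U. \<xi> q = E 5 q) \<and>
     (\<forall>q\<in>U. \<forall>u\<in>tangent_space M q. \<forall>v\<in>tangent_space M q.
        fundamental_form g \<phi> q u v =
          wedge11 (g q (E 1 q)) (g q (E 2 q)) u v + wedge11 (g q (E 3 q)) (g q (E 4 q)) u v)"


section \<open>Connections\<close>

text \<open>
  \<open>D p v Y\<close> is the covariant derivative at \<open>p\<close>, in the direction of the tangent vector \<open>v\<close>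
  at \<open>p\<close>, of a vector field \<open>Y\<close> that is defined and smooth near \<open>p\<close>.
\<close>

type_synonym 'a conn = "'a \<Rightarrow> 'a tvec \<Rightarrow> 'a field \<Rightarrow> 'a tvec"

definition connection :: "'a::topological_space chart set \<Rightarrow> 'a conn \<Rightarrow> bool" where
  "connection M D \<longleftrightarrow>
     (\<forall>p\<in>points M. \<forall>v\<in>tangent_space M p. \<forall>Y. field_near M p Y \<longrightarrow> D p v Y \<in> tangent_space M p) \<and>
     (\<forall>p\<in>points M. \<forall>u\<in>tangent_space M p. \<forall>v\<in>tangent_space M p. \<forall>a b Y. field_near M p Y \<longrightarrow>
        D p (tscale a u + tscale b v) Y = tscale a (D p u Y) + tscale b (D p v Y)) \<and>
     (\<forall>p\<in>points M. \<forall>v\<in>tangent_space M p. \<forall>Y Z. field_near M p Y \<and> field_near M p Z \<longrightarrow>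
        D p v (\<lambda>q. Y q + Z q) = D p v Y + D p v Z) \<and>
     (\<forall>p\<in>points M. \<forall>v\<in>tangent_space M p. \<forall>f Y. smooth_near M p f \<and> field_near M p Y \<longrightarrow>
        D p v (\<lambda>q. tscale (f q) (Y q)) = tscale (v f) (Y p) + tscale (f p) (D p v Y)) \<and>
     (\<forall>p\<in>points M. \<forall>v\<in>tangent_space M p. \<forall>Y Z U.
        field_near M p Y \<and> open_in M U \<and> p \<in> U \<and> (\<forall>q\<in>U. Y q = Z q) \<longrightarrow> D p v Y = D p v Z) \<and>
     (\<forall>U X Y. open_in M U \<and> smooth_field M U X \<and> smooth_field M U Y \<longrightarrow>
        smooth_field M U (\<lambda>q. D q (X q) Y))"

definition metric_connection ::
    "'a::topological_space chart set \<Rightarrow> 'a metric_field \<Rightarrow> 'a conn \<Rightarrow> bool" where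
  "metric_connection M g D \<longleftrightarrow>
     connection M D \<and>
     (\<forall>p\<in>points M. \<forall>v\<in>tangent_space M p. \<forall>Y Z. field_near M p Y \<and> field_near M p Z \<longrightarrow>
        v (\<lambda>q. g q (Y q) (Z q)) = g p (D p v Y) (Z p) + g p (Y p) (D p v Z))"

definition torsion_vector ::
    "'a::topological_space chart set \<Rightarrow> 'a conn \<Rightarrow> 'a \<Rightarrow> 'a field \<Rightarrow> 'a field \<Rightarrow> 'a tvec" where
  "torsion_vector M D p X Y = D p (X p) Y - D p (Y p) X - lie_bracket M p X Y"

definition torsion ::
    "'a::topological_space chart set \<Rightarrow> 'a metric_field \<Rightarrow> 'a conn \<Rightarrow> 'a \<Rightarrow>
     'a field \<Rightarrow> 'a field \<Rightarrow> 'a field \<Rightarrow> real" where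
  "torsion M g D p X Y Z = g p (torsion_vector M D p X Y) (Z p)"

definition levi_civita ::
    "'a::topological_space chart set \<Rightarrow> 'a metric_field \<Rightarrow> 'a conn \<Rightarrow> bool" where
  "levi_civita M g D \<longleftrightarrow>
     metric_connection M g D \<and>
     (\<forall>p\<in>points M. \<forall>X Y. field_near M p X \<and> field_near M p Y \<longrightarrow> torsion_vector M D p X Y = 0)"

definition vectorial_torsion ::
    "'a::topological_space chart set \<Rightarrow> 'a metric_field \<Rightarrow> 'a conn \<Rightarrow> bool" where
  "vectorial_torsion M g D \<longleftrightarrow>
     (\<exists>\<alpha>. one_form M \<alpha> \<and>
        (\<forall>p\<in>points M. \<forall>X Y Z. field_near M p X \<and> field_near M p Y \<and> field_near M p Z \<longrightarrow>
           torsion M g D p X Y Z = \<alpha> p (X p) * g p (Y p) (Z p) - \<alpha> p (Y p) * g p (X p) (Z p)))"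

definition skew_torsion ::
    "'a::topological_space chart set \<Rightarrow> 'a metric_field \<Rightarrow> 'a conn \<Rightarrow> bool" where
  "skew_torsion M g D \<longleftrightarrow>
     (\<forall>p\<in>points M. \<forall>X Y Z. field_near M p X \<and> field_near M p Y \<and> field_near M p Z \<longrightarrow>
        torsion M g D p X Y Z + torsion M g D p X Z Y = 0)"

definition traceless_cyclic_torsion ::
    "'a::topological_space chart set \<Rightarrow> 'a metric_field \<Rightarrow> 'a conn \<Rightarrow> bool" where
  "traceless_cyclic_torsion M g D \<longleftrightarrow>
     (\<forall>p\<in>points M. \<forall>X Y Z. field_near M p X \<and> field_near M p Y \<and> field_near M p Z \<longrightarrow>
        torsion M g D p X Y Z + torsion M g D p Y Z X + torsion M g D p Z X Y = 0) \<and>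
     (\<forall>p\<in>points M. \<forall>X U E.
        field_near M p X \<and> open_in M U \<and> p \<in> U \<and> orthonormal_frame M g U E \<longrightarrow>
        (\<Sum>i\<in>UNIV. torsion M g D p X (E i) (E i)) = 0)"

definition compatible ::
    "'a::topological_space chart set \<Rightarrow> 'a field \<Rightarrow> ('a \<Rightarrow> 'a tvec \<Rightarrow> real) \<Rightarrow>
     ('a \<Rightarrow> 'a tvec \<Rightarrow> 'a tvec) \<Rightarrow> 'a conn \<Rightarrow> bool" where
  "compatible M \<xi> \<eta> \<phi> D \<longleftrightarrow>
     (\<forall>p\<in>points M. \<forall>v\<in>tangent_space M p. D p v \<xi> = 0) \<and>
     (\<forall>p\<in>points M. \<forall>v\<in>tangent_space M p. \<forall>Y. field_near M p Y \<longrightarrow>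
        v (\<lambda>q. \<eta> q (Y q)) - \<eta> p (D p v Y) = 0) \<and>
     (\<forall>p\<in>points M. \<forall>v\<in>tangent_space M p. \<forall>Y. field_near M p Y \<longrightarrow>
        D p v (\<lambda>q. \<phi> q (Y q)) - \<phi> p (D p v Y) = 0)"


section \<open>Intrinsic torsion\<close>

text \<open>The vector with components \<open>X\<close> in the frame \<open>E\<close> at \<open>p\<close>.\<close>

definition frame_vector :: "(5 \<Rightarrow> 'a field) \<Rightarrow> 'a \<Rightarrow> vec5 \<Rightarrow> 'a tvec" where
  "frame_vector E p X = (\<Sum>k\<in>UNIV. tscale (X$k) (E k p))"

text \<open>The connection forms, and the tensor \<open>\<Omega>\<close> at \<open>p\<close>, transported to the local model by
  the frame \<open>E\<close>.\<close>

definition conn_form ::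
    "'a metric_field \<Rightarrow> 'a conn \<Rightarrow> (5 \<Rightarrow> 'a field) \<Rightarrow> 'a \<Rightarrow> 5 \<Rightarrow> 5 \<Rightarrow> form1" where
  "conn_form g D E p i j X = g p (D p (frame_vector E p X) (E i)) (E j p)"

definition Omega :: "'a metric_field \<Rightarrow> 'a conn \<Rightarrow> (5 \<Rightarrow> 'a field) \<Rightarrow> 'a \<Rightarrow> form3" where
  "Omega g D E p X Y Z =
     (\<Sum>(i, j)\<in>{(i, j). i < j}.
        conn_form g D E p i j X * wedge11 (flat (bvec i)) (flat (bvec j)) Y Z)"

definition intrinsic_torsion :: "'a metric_field \<Rightarrow> 'a conn \<Rightarrow> (5 \<Rightarrow> 'a field) \<Rightarrow> 'a \<Rightarrow> form3" where
  "intrinsic_torsion g D E p = pr_W (Omega g D E p)"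

text \<open>
  The manifold is of class \<open>W\<close>, for a subspace \<open>W\<close> of the local model that is invariant under
  the structure group \<open>U(2)\<close>; \<open>D\<close> is the Levi-Civita connection.
\<close>

definition of_class ::
    "'a::topological_space chart set \<Rightarrow> 'a metric_field \<Rightarrow> 'a field \<Rightarrow>
     ('a \<Rightarrow> 'a tvec \<Rightarrow> 'a tvec) \<Rightarrow> 'a conn \<Rightarrow> form3 set \<Rightarrow> bool" where
  "of_class M g \<xi> \<phi> D W \<longleftrightarrow>
     (\<forall>p\<in>points M. \<forall>U E. open_in M U \<and> p \<in> U \<and> adapted_frame M g \<xi> \<phi> U E \<longrightarrow>
        intrinsic_torsion g D E p \<in> W)"

end

(* Write S for the difference of the connection forms of the Levi-Civita connection and of the
   compatible connection in an adapted frame. The forms of a compatible connection take values in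
   u(2), so its image under pr_W vanishes and the intrinsic torsion is pr_W S. The Koszul formula
   expresses S through the torsion T: if T is vectorial then S lies in the image of theta1, if T is
   skew then S is a 3-form, and if T is traceless cyclic then S lies in A3.

   What remains is linear algebra. Every 2-form splits along Lam21, ..., Lam24 and the Hodge operator
   is onto the 3-forms, which settles the skew case. For S in A3 put t = S(xi, xi, .) and let s be the
   horizontal part of S(., xi, .). Then t determines the W2-component; the symmetric part of s is
   traceless and gives the components in W8 and W10 (phi-invariant and phi-anti-invariant part); by
   cyclicity the skew part of s determines the horizontal 2-form S(xi, ., .), and splitting it along
   Lam21, Lam22, Lam23 gives the components in W3, W7, W5. The rest lies in Lam12 tensor Lam22 = W6 + W9. *)

theory Submission
  imports Defs
begin

section \<open>Coordinates and the volume form\<close>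

lemma exhaust_5: "x = 1 \<or> x = 2 \<or> x = 3 \<or> x = 4 \<or> x = (5 :: 5)"
proof (induct x)
  case (of_int z)
  \<comment> \<open>The representative 0 is the element written \<open>5\<close>.\<close>
  then have "z = 0 \<or> z = 1 \<or> z = 2 \<or> z = 3 \<or> z = 4" by fastforce
  then show ?case by auto
qed

lemma forall_5: "(\<forall>i::5. P i) \<longleftrightarrow> P 1 \<and> P 2 \<and> P 3 \<and> P 4 \<and> P 5"
  by (metis exhaust_5)

lemma UNIV_5: "UNIV = {1, 2, 3, 4, 5::5}"
  using exhaust_5 by auto

lemma sum_5: "sum f (UNIV::5 set) = f 1 + f 2 + f 3 + f 4 + f 5"
  unfolding UNIV_5 by (simp add: ac_simps)

lemma prod_5: "prod f (UNIV::5 set) = f 1 * f 2 * f 3 * f 4 * f 5"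
  unfolding UNIV_5 by (simp add: ac_simps)

lemma less_5:
  "(1::5) < 2" "(1::5) < 3" "(1::5) < 4" "(2::5) < 3" "(2::5) < 4" "(3::5) < 4"
  "(5::5) < 1" "(5::5) < 2" "(5::5) < 3" "(5::5) < 4"
  by (simp_all add: less_bit1_def bit1.Rep_numeral bit1.Rep_1 bit1.Rep_0)

lemma sum_less_5:
  "(\<Sum>(i, j)\<in>{(i, j :: 5). i < j}. f i j) =
     f 1 2 + f 1 3 + f 1 4 + f 2 3 + f 2 4 + f 3 4 + f 5 1 + f 5 2 + f 5 3 + f 5 4"
proof -
  have "{(i, j :: 5). i < j} =
      {(1,2), (1,3), (1,4), (2,3), (2,4), (3,4), (5,1), (5,2), (5,3), (5,4)}"
    using less_5 by (auto simp: set_eq_iff forall_5 dest: less_not_sym)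
  then show ?thesis by (simp add: ac_simps)
qed

lemma bvec_nth: "bvec i $ j = (if i = j then 1 else 0)"
  by (simp add: axis_def)

lemma flat_bvec: "bvec i \<bullet> X = X $ i"
  by (simp add: inner_axis')

lemma linear_eq_bvec:
  fixes f h :: "vec5 \<Rightarrow> 'b::real_vector"
  assumes "linear f" "linear h" "\<And>i. f (bvec i) = h (bvec i)"
  shows "f = h"
  using assms(1,2) by (rule linear_eq_stdbasis) (use assms(3) in \<open>auto simp: Basis_vec_def\<close>)

text \<open>Linearity frees one slot at a time, starting with the last.\<close>

lemma trilinear_eqI:
  assumes "trilinear A" "trilinear B"
    and "\<And>i j k. A (bvec i) (bvec j) (bvec k) = B (bvec i) (bvec j) (bvec k)"
  shows "A = B"
proof -
  have "(\<lambda>Z. A (bvec i) (bvec j) Z) = (\<lambda>Z. B (bvec i) (bvec j) Z)" for i j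
    using assms by (intro linear_eq_bvec) (auto simp: trilinear_def)
  then have "A (bvec i) (bvec j) Z = B (bvec i) (bvec j) Z" for i j Z by (simp add: fun_eq_iff)
  then have "(\<lambda>Y. A (bvec i) Y Z) = (\<lambda>Y. B (bvec i) Y Z)" for i Z
    using assms by (intro linear_eq_bvec) (auto simp: trilinear_def)
  then have "A (bvec i) Y Z = B (bvec i) Y Z" for i Y Z by (simp add: fun_eq_iff)
  then have "(\<lambda>X. A X Y Z) = (\<lambda>X. B X Y Z)" for Y Z
    using assms by (intro linear_eq_bvec) (auto simp: trilinear_def)
  then show ?thesis by (simp add: fun_eq_iff)
qed

lemma bilinear_iff: "bilinear f \<longleftrightarrow> (\<forall>X. linear (f X)) \<and> (\<forall>Y. linear (\<lambda>X. f X Y))"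
  by (auto simp: bilinear_def)

lemma trilinear_iff:
  "trilinear A \<longleftrightarrow>
     (\<forall>X X' Y Z a. A (X + X') Y Z = A X Y Z + A X' Y Z \<and> A (a *\<^sub>R X) Y Z = a * A X Y Z) \<and>
     (\<forall>X Y Y' Z a. A X (Y + Y') Z = A X Y Z + A X Y' Z \<and> A X (a *\<^sub>R Y) Z = a * A X Y Z) \<and>
     (\<forall>X Y Z Z' a. A X Y (Z + Z') = A X Y Z + A X Y Z' \<and> A X Y (a *\<^sub>R Z) = a * A X Y Z)"
  unfolding trilinear_def linear_iff real_scaleR_def by (intro iffI conjI allI; blast)

text \<open>Skew-symmetry carries linearity from the second slot to the first, so only one slot has
  to be checked.\<close>

lemma alt2_iff:
  "\<alpha> \<in> alt2 \<longleftrightarrow>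
     (\<forall>X Y Y'. \<alpha> X (Y + Y') = \<alpha> X Y + \<alpha> X Y') \<and> (\<forall>X Y a. \<alpha> X (a *\<^sub>R Y) = a * \<alpha> X Y) \<and>
     (\<forall>X Y. \<alpha> X Y = - \<alpha> Y X)"
proof -
  have "\<alpha> (X + X') Y = \<alpha> X Y + \<alpha> X' Y" "\<alpha> (a *\<^sub>R X) Y = a * \<alpha> X Y"
    if "\<forall>X Y Y'. \<alpha> X (Y + Y') = \<alpha> X Y + \<alpha> X Y'" "\<forall>X Y a. \<alpha> X (a *\<^sub>R Y) = a * \<alpha> X Y"
       "\<forall>X Y. \<alpha> X Y = - \<alpha> Y X" for X X' Y a
    using that(1)[rule_format, of Y X X'] that(2)[rule_format, of Y a X]
      that(3)[rule_format, of "X + X'" Y] that(3)[rule_format, of X Y] that(3)[rule_format, of X' Y]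
      that(3)[rule_format, of "a *\<^sub>R X" Y] by simp_all
  then show ?thesis
    unfolding alt2_def bilinear_iff linear_iff real_scaleR_def mem_Collect_eq by meson
qed

text \<open>The ten pairs are those increasing in the order with 5 least; skew-symmetry in the last
  two slots gives all others.\<close>

lemma Aspace_eqI:
  assumes "A \<in> Aspace" "B \<in> Aspace"
    and "\<forall>i. A (bvec i) (bvec 1) (bvec 2) = B (bvec i) (bvec 1) (bvec 2)"
      "\<forall>i. A (bvec i) (bvec 1) (bvec 3) = B (bvec i) (bvec 1) (bvec 3)"
      "\<forall>i. A (bvec i) (bvec 1) (bvec 4) = B (bvec i) (bvec 1) (bvec 4)"
      "\<forall>i. A (bvec i) (bvec 2) (bvec 3) = B (bvec i) (bvec 2) (bvec 3)"
      "\<forall>i. A (bvec i) (bvec 2) (bvec 4) = B (bvec i) (bvec 2) (bvec 4)"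
      "\<forall>i. A (bvec i) (bvec 3) (bvec 4) = B (bvec i) (bvec 3) (bvec 4)"
      "\<forall>i. A (bvec i) (bvec 5) (bvec 1) = B (bvec i) (bvec 5) (bvec 1)"
      "\<forall>i. A (bvec i) (bvec 5) (bvec 2) = B (bvec i) (bvec 5) (bvec 2)"
      "\<forall>i. A (bvec i) (bvec 5) (bvec 3) = B (bvec i) (bvec 5) (bvec 3)"
      "\<forall>i. A (bvec i) (bvec 5) (bvec 4) = B (bvec i) (bvec 5) (bvec 4)"
  shows "A = B"
proof -
  have skew: "C X Y Z = - C X Z Y" if "C \<in> Aspace" for C X Y Z
    using that by (auto simp: Aspace_def eq_neg_iff_add_eq_0)
  \<comment> \<open>The condition \<open>j < i\<close> turns skew-symmetry into a terminating
    rewrite rule.\<close>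
  have sort: "C X (bvec i) (bvec j) = - C X (bvec j) (bvec i)"
    if "C \<in> Aspace" "j < i" for C X i j
    using that(1) by (rule skew)
  have diag: "C X Y Y = 0" if "C \<in> Aspace" for C X Y
    using skew[OF that, of X Y Y] by simp
  have "\<forall>i j k. A (bvec i) (bvec j) (bvec k) = B (bvec i) (bvec j) (bvec k)"
    using assms(3-) by (simp add: forall_5 sort diag less_5 assms(1,2))
  moreover have "trilinear A" "trilinear B"
    using assms(1,2) unfolding Aspace_def by blast+
  ultimately show ?thesis by (intro trilinear_eqI) blast+
qed

lemma alt2_eqI:
  assumes "\<alpha> \<in> alt2" "\<beta> \<in> alt2"
    and "\<alpha> (bvec 1) (bvec 2) = \<beta> (bvec 1) (bvec 2)" "\<alpha> (bvec 1) (bvec 3) = \<beta> (bvec 1) (bvec 3)"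
      "\<alpha> (bvec 1) (bvec 4) = \<beta> (bvec 1) (bvec 4)" "\<alpha> (bvec 2) (bvec 3) = \<beta> (bvec 2) (bvec 3)"
      "\<alpha> (bvec 2) (bvec 4) = \<beta> (bvec 2) (bvec 4)" "\<alpha> (bvec 3) (bvec 4) = \<beta> (bvec 3) (bvec 4)"
      "\<alpha> (bvec 5) (bvec 1) = \<beta> (bvec 5) (bvec 1)" "\<alpha> (bvec 5) (bvec 2) = \<beta> (bvec 5) (bvec 2)"
      "\<alpha> (bvec 5) (bvec 3) = \<beta> (bvec 5) (bvec 3)" "\<alpha> (bvec 5) (bvec 4) = \<beta> (bvec 5) (bvec 4)"
  shows "\<alpha> = \<beta>"
proof -
  \<comment> \<open>Tensoring with the first coordinate form reduces the claim to
    \<open>Aspace_eqI\<close>; evaluating at \<open>bvec 1\<close> recovers the 2-forms.\<close>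
  have "(\<lambda>(X::vec5) Y Z. X $ 1 * \<alpha> Y Z) = (\<lambda>(X::vec5) Y Z. X $ 1 * \<beta> Y Z)"
  proof -
    have "(\<lambda>(X::vec5) Y Z. X $ 1 * \<gamma> Y Z) \<in> Aspace" if "\<gamma> \<in> alt2" for \<gamma>
      unfolding Aspace_def mem_Collect_eq
    proof (intro conjI allI)
      have "bilinear \<gamma>" using that by (simp add: alt2_def)
      then show "trilinear (\<lambda>(X::vec5) Y Z. X $ 1 * \<gamma> Y Z)"
        by (auto simp: trilinear_iff bilinear_iff linear_iff algebra_simps)
      fix X :: vec5 and Y Z
      show "X $ 1 * \<gamma> Y Z + X $ 1 * \<gamma> Z Y = 0"
        using that[unfolded alt2_iff, THEN conjunct2, THEN conjunct2, rule_format, of Y Z]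
        by simp
    qed
    from this[OF assms(1)] this[OF assms(2)] show ?thesis
      by (rule Aspace_eqI) (simp_all add: assms(3-))
  qed
  from fun_cong[OF this, of "bvec 1"] have "\<alpha> Y Z = \<beta> Y Z" for Y Z
    by (simp add: bvec_nth fun_eq_iff)
  then show ?thesis by (intro ext)
qed

section \<open>Alternating 3-forms\<close>

text \<open>\<open>Aspace\<close> already contains skew-symmetry in the last two slots, and adjacent
  transpositions generate all permutations.\<close>

definition alt3 :: "form3 set" where
  "alt3 = {A \<in> Aspace. \<forall>X Y Z. A X Y Z + A Y X Z = 0}"

lemma alt3_bvec_sort:
  assumes "A \<in> alt3" "j < i"
  shows "A (bvec i) (bvec j) Z = - A (bvec j) (bvec i) Z" "A Z (bvec i) (bvec j) = - A Z (bvec j) (bvec i)"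
  using assms(1) unfolding alt3_def Aspace_def eq_neg_iff_add_eq_0 by blast+

lemma alt3_diag:
  assumes "A \<in> alt3"
  shows "A X X Z = 0" "A Z X X = 0"
proof -
  have "A X X Z + A X X Z = 0" "A Z X X + A Z X X = 0"
    using assms unfolding alt3_def Aspace_def by blast+
  then show "A X X Z = 0" "A Z X X = 0" by simp_all
qed

lemma alt3_eqI:
  assumes "A \<in> alt3" "B \<in> alt3"
    and "A (bvec 1) (bvec 2) (bvec 3) = B (bvec 1) (bvec 2) (bvec 3)"
      "A (bvec 1) (bvec 2) (bvec 4) = B (bvec 1) (bvec 2) (bvec 4)"
      "A (bvec 5) (bvec 1) (bvec 2) = B (bvec 5) (bvec 1) (bvec 2)"
      "A (bvec 1) (bvec 3) (bvec 4) = B (bvec 1) (bvec 3) (bvec 4)"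
      "A (bvec 5) (bvec 1) (bvec 3) = B (bvec 5) (bvec 1) (bvec 3)"
      "A (bvec 5) (bvec 1) (bvec 4) = B (bvec 5) (bvec 1) (bvec 4)"
      "A (bvec 2) (bvec 3) (bvec 4) = B (bvec 2) (bvec 3) (bvec 4)"
      "A (bvec 5) (bvec 2) (bvec 3) = B (bvec 5) (bvec 2) (bvec 3)"
      "A (bvec 5) (bvec 2) (bvec 4) = B (bvec 5) (bvec 2) (bvec 4)"
      "A (bvec 5) (bvec 3) (bvec 4) = B (bvec 5) (bvec 3) (bvec 4)"
  shows "A = B"
proof -
  have "\<forall>i j k. A (bvec i) (bvec j) (bvec k) = B (bvec i) (bvec j) (bvec k)"
    using assms(3-) by (simp add: forall_5 alt3_bvec_sort alt3_diag less_5 assms(1,2))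
  moreover have "trilinear A" "trilinear B"
    using assms(1,2) unfolding alt3_def Aspace_def by blast+
  ultimately show ?thesis by (intro trilinear_eqI) blast+
qed

section \<open>The volume form and the Hodge operator on basis vectors\<close>

text \<open>The Leibniz expansion makes linearity in each slot visible.\<close>

lemma vol_eq:
  "vol V1 V2 V3 V4 V5 =
     (\<Sum>p | p permutes (UNIV :: 5 set).
        of_int (sign p) * (V1 $ p 1 * V2 $ p 2 * V3 $ p 3 * V4 $ p 4 * V5 $ p 5))"
  by (simp add: vol_def det_def prod_5)

lemma det_swap_rows:
  fixes A :: "real^'n^'n"
  assumes "i \<noteq> j"
  shows "det (\<chi> k. A $ Transposition.transpose i j k) = - det A"
  using det_permute_rows[OF permutes_swap_id[of i UNIV j], of A] assms
  by (simp add: sign_swap_id)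

lemma vol_swap:
  "vol b a c d e = - vol a b c d e" "vol a c b d e = - vol a b c d e"
  "vol a b d c e = - vol a b c d e" "vol a b c e d = - vol a b c d e"
proof -
  have vol_transpose:
    "det (\<chi> k. (\<chi> i. if i = 1 then a else if i = 2 then b else if i = 3 then c
                else if i = 4 then d else e :: real^5^5) $ Transposition.transpose i j k) = - vol a b c d e"
    if "i \<noteq> j" for i j :: 5
    by (simp only: det_swap_rows[OF that] vol_def)
  show "vol b a c d e = - vol a b c d e"
    by (subst vol_transpose[of 1 2, symmetric], simp, unfold vol_def, rule arg_cong[of _ _ det])
       (simp add: vec_eq_iff forall_5 transpose_def)
  show "vol a c b d e = - vol a b c d e"
    by (subst vol_transpose[of 2 3, symmetric], simp, unfold vol_def, rule arg_cong[of _ _ det])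
       (simp add: vec_eq_iff forall_5 transpose_def)
  show "vol a b d c e = - vol a b c d e"
    by (subst vol_transpose[of 3 4, symmetric], simp, unfold vol_def, rule arg_cong[of _ _ det])
       (simp add: vec_eq_iff forall_5 transpose_def)
  show "vol a b c e d = - vol a b c d e"
    by (subst vol_transpose[of 4 5, symmetric], simp, unfold vol_def, rule arg_cong[of _ _ det])
       (simp add: vec_eq_iff forall_5 transpose_def)
qed

lemma vol_repeat: "vol a a c d e = 0" "vol a b b d e = 0" "vol a b c c e = 0" "vol a b c d d = 0"
  using vol_swap(1)[of a a c d e] vol_swap(2)[of a b b d e]
    vol_swap(3)[of a b c c e] vol_swap(4)[of a b c d d] by simp_all

lemma vol_bvec_standard: "vol (bvec 1) (bvec 2) (bvec 3) (bvec 4) (bvec 5) = 1"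
proof -
  have "(\<chi> i. if i = 1 then bvec 1 else if i = 2 then bvec 2 else if i = 3 then bvec 3
          else if i = 4 then bvec 4 else bvec 5) = (mat 1 :: real^5^5)"
    by (simp add: vec_eq_iff forall_5 mat_def bvec_nth)
  then show ?thesis by (simp add: vol_def)
qed

text \<open>Each summand is a constant times the volume form in its last three slots, so linearity
  and skew-symmetry hold termwise.\<close>

lemma hodge_in_alt3: "hodge \<alpha> \<in> alt3"
proof -
  have sk: "vol (bvec i) (bvec j) X Y Z + vol (bvec i) (bvec j) X Z Y = 0"
           "vol (bvec i) (bvec j) X Y Z + vol (bvec i) (bvec j) Y X Z = 0" for i j X Y Z
    using vol_swap(4)[of "bvec i" "bvec j" X Y Z] vol_swap(3)[of "bvec i" "bvec j" X Y Z] by simp_all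
  have lin: "vol a b (X + X') Y Z = vol a b X Y Z + vol a b X' Y Z"
    "vol a b Y (X + X') Z = vol a b Y X Z + vol a b Y X' Z"
    "vol a b Y Z (X + X') = vol a b Y Z X + vol a b Y Z X'"
    "vol a b (r *\<^sub>R X) Y Z = r * vol a b X Y Z"
    "vol a b Y (r *\<^sub>R X) Z = r * vol a b Y X Z"
    "vol a b Y Z (r *\<^sub>R X) = r * vol a b Y Z X" for a b X X' Y Z r
    by (simp_all add: vol_eq algebra_simps sum.distrib sum_distrib_left)
  have "hodge \<alpha> X Y Z + hodge \<alpha> X Z Y = 0" "hodge \<alpha> X Y Z + hodge \<alpha> Y X Z = 0" for X Y Z
    unfolding hodge_def sum.distrib[symmetric]
    by (auto intro!: sum.neutral simp: distrib_left[symmetric] sk)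
  moreover have "trilinear (hodge \<alpha>)"
    unfolding trilinear_iff hodge_def sum_less_5 lin by (simp add: algebra_simps)
  ultimately show ?thesis by (simp add: alt3_def Aspace_def)
qed

text \<open>Together with \<open>less_5\<close>, conditional rewriting with such rules sorts arguments that are basis
  vectors. The vector \<open>e\<^sub>5\<close> comes first, since 5 = 0 is the least element of the index type.\<close>

lemma vol_bvec_sort:
  assumes "j < i"
  shows "vol (bvec i) (bvec j) c d e = - vol (bvec j) (bvec i) c d e"
    "vol a (bvec i) (bvec j) d e = - vol a (bvec j) (bvec i) d e"
    "vol a b (bvec i) (bvec j) e = - vol a b (bvec j) (bvec i) e"
    "vol a b c (bvec i) (bvec j) = - vol a b c (bvec j) (bvec i)"
  by (rule vol_swap)+

text \<open>Moving the last vector to the front takes four transpositions, hence no sign.\<close>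

lemma vol_bvec_sorted: "vol (bvec 5) (bvec 1) (bvec 2) (bvec 3) (bvec 4) = 1"
  using vol_bvec_standard by (simp only: vol_bvec_sort less_5 minus_minus)

text \<open>Only the complementary pair of indices survives in the sum; its sign is that of sorting
  all five indices.\<close>

lemma hodge_bvec:
  "hodge \<alpha> (bvec 1) (bvec 2) (bvec 3) = - \<alpha> (bvec 5) (bvec 4)"
  "hodge \<alpha> (bvec 1) (bvec 2) (bvec 4) = \<alpha> (bvec 5) (bvec 3)"
  "hodge \<alpha> (bvec 5) (bvec 1) (bvec 2) = \<alpha> (bvec 3) (bvec 4)"
  "hodge \<alpha> (bvec 1) (bvec 3) (bvec 4) = - \<alpha> (bvec 5) (bvec 2)"
  "hodge \<alpha> (bvec 5) (bvec 1) (bvec 3) = - \<alpha> (bvec 2) (bvec 4)"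
  "hodge \<alpha> (bvec 5) (bvec 1) (bvec 4) = \<alpha> (bvec 2) (bvec 3)"
  "hodge \<alpha> (bvec 2) (bvec 3) (bvec 4) = \<alpha> (bvec 5) (bvec 1)"
  "hodge \<alpha> (bvec 5) (bvec 2) (bvec 3) = \<alpha> (bvec 1) (bvec 4)"
  "hodge \<alpha> (bvec 5) (bvec 2) (bvec 4) = - \<alpha> (bvec 1) (bvec 3)"
  "hodge \<alpha> (bvec 5) (bvec 3) (bvec 4) = \<alpha> (bvec 1) (bvec 2)"
  unfolding hodge_def sum_less_5
  by (simp_all add: vol_bvec_sort less_5 vol_repeat vol_bvec_sorted)

section \<open>The summands of the two-forms\<close>

lemma alt2D:
  assumes "\<alpha> \<in> alt2"
  shows "\<alpha> (X + X') Y = \<alpha> X Y + \<alpha> X' Y" "\<alpha> (X - X') Y = \<alpha> X Y - \<alpha> X' Y"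
    "\<alpha> (- X) Y = - \<alpha> X Y" "\<alpha> (a *\<^sub>R X) Y = a * \<alpha> X Y" "\<alpha> 0 Y = 0"
    "\<alpha> X (Y + Y') = \<alpha> X Y + \<alpha> X Y'" "\<alpha> X (Y - Y') = \<alpha> X Y - \<alpha> X Y'"
    "\<alpha> X (- Y) = - \<alpha> X Y" "\<alpha> X (a *\<^sub>R Y) = a * \<alpha> X Y" "\<alpha> X 0 = 0"
    "\<alpha> X X = 0"
proof -
  have "bilinear \<alpha>" and skew: "\<alpha> X X = - \<alpha> X X"
    using assms unfolding alt2_def by blast+
  then have l: "linear (\<lambda>X. \<alpha> X Y)" and r: "linear (\<alpha> X)" by (simp_all add: bilinear_iff)
  show "\<alpha> (X + X') Y = \<alpha> X Y + \<alpha> X' Y" "\<alpha> (X - X') Y = \<alpha> X Y - \<alpha> X' Y"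
    "\<alpha> (- X) Y = - \<alpha> X Y" "\<alpha> (a *\<^sub>R X) Y = a * \<alpha> X Y" "\<alpha> 0 Y = 0"
    using linear_add[OF l] linear_diff[OF l] linear_neg[OF l] linear_scale[OF l] linear_0[OF l]
    by simp_all
  show "\<alpha> X (Y + Y') = \<alpha> X Y + \<alpha> X Y'" "\<alpha> X (Y - Y') = \<alpha> X Y - \<alpha> X Y'"
    "\<alpha> X (- Y) = - \<alpha> X Y" "\<alpha> X (a *\<^sub>R Y) = a * \<alpha> X Y" "\<alpha> X 0 = 0"
    using linear_add[OF r] linear_diff[OF r] linear_neg[OF r] linear_scale[OF r] linear_0[OF r]
    by simp_all
  show "\<alpha> X X = 0" using skew by simp
qed

lemma alt2_skew: "\<alpha> \<in> alt2 \<Longrightarrow> \<alpha> X Y = - \<alpha> Y X"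
  unfolding alt2_def by blast

lemma alt2_bvec_sort: "\<alpha> \<in> alt2 \<Longrightarrow> j < i \<Longrightarrow> \<alpha> (bvec i) (bvec j) = - \<alpha> (bvec j) (bvec i)"
  by (rule alt2_skew)

lemma alt2I:
  assumes "\<And>X Y Y'. \<alpha> X (Y + Y') = \<alpha> X Y + \<alpha> X Y'" "\<And>X Y a. \<alpha> X (a *\<^sub>R Y) = a * \<alpha> X Y"
    and "\<And>X Y. \<alpha> X Y + \<alpha> Y X = 0"
  shows "\<alpha> \<in> alt2"
  using assms unfolding alt2_iff eq_neg_iff_add_eq_0 by blast

lemma alt2_add: "\<alpha> \<in> alt2 \<Longrightarrow> \<beta> \<in> alt2 \<Longrightarrow> \<alpha> + \<beta> \<in> alt2"
proof (rule alt2I)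
  fix X Y assume "\<alpha> \<in> alt2" "\<beta> \<in> alt2"
  then show "(\<alpha> + \<beta>) X Y + (\<alpha> + \<beta>) Y X = 0"
    using alt2_skew[of \<alpha> X Y] alt2_skew[of \<beta> X Y] by simp
qed (simp_all add: alt2D algebra_simps)

lemma alt2_uminus: "\<alpha> \<in> alt2 \<Longrightarrow> - \<alpha> \<in> alt2"
proof (rule alt2I)
  fix X Y assume "\<alpha> \<in> alt2"
  then show "(- \<alpha>) X Y + (- \<alpha>) Y X = 0"
    using alt2_skew[of \<alpha> X Y] by simp
qed (simp_all add: alt2D)

lemma alt2_diff: "\<alpha> \<in> alt2 \<Longrightarrow> \<beta> \<in> alt2 \<Longrightarrow> \<alpha> - \<beta> \<in> alt2"
  using alt2_add[of \<alpha> "- \<beta>"] alt2_uminus[of \<beta>] by simp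

section \<open>Two-forms from coefficients, and equations for the summands\<close>

text \<open>Only coefficients with \<open>i < j\<close> are read. As 5 is least, the case
  \<open>i = 5\<close> in later witnesses covers exactly the terms containing \<eta>.\<close>

definition form2_of :: "(5 \<Rightarrow> 5 \<Rightarrow> real) \<Rightarrow> form2" where
  "form2_of a X Y = (\<Sum>(i, j)\<in>{(i, j). i < j}. a i j * wedge11 (flat (bvec i)) (flat (bvec j)) X Y)"

lemma form2_of_in_alt2: "form2_of a \<in> alt2"
  unfolding form2_of_def sum_less_5 by (simp add: alt2_iff wedge11_def inner_add_right algebra_simps)

lemma form2_of_bvec: "i < j \<Longrightarrow> form2_of a (bvec i) (bvec j) = a i j"
  unfolding form2_of_def by (subst sum.remove[of _ "(i, j)"])
    (auto simp: wedge11_def flat_bvec bvec_nth intro!: sum.neutral split: if_splits)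

lemma form2_of_self: "\<alpha> \<in> alt2 \<Longrightarrow> form2_of (\<lambda>i j. \<alpha> (bvec i) (bvec j)) = \<alpha>"
  by (rule alt2_eqI) (simp_all add: form2_of_in_alt2 form2_of_bvec less_5)

lemma phi0_bvec:
  "phi0 (bvec 1) = - bvec 2" "phi0 (bvec 2) = bvec 1" "phi0 (bvec 3) = - bvec 4"
  "phi0 (bvec 4) = bvec 3" "phi0 (bvec 5) = 0"
  by (simp_all add: phi0_def bvec_nth)

lemma phi0_linear: "phi0 (X + Y) = phi0 X + phi0 Y" "phi0 (a *\<^sub>R X) = a *\<^sub>R phi0 X"
  by (simp_all add: phi0_def algebra_simps)

lemma phi0_uminus: "phi0 (- X) = - phi0 X"
  by (simp add: phi0_def)

lemma phi0_0: "phi0 0 = 0"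
  by (simp add: phi0_def)

lemma phi0_nth:
  "phi0 X $ 1 = X $ 2" "phi0 X $ 2 = - X $ 1" "phi0 X $ 3 = X $ 4" "phi0 X $ 4 = - X $ 3" "phi0 X $ 5 = 0"
  by (simp_all add: phi0_def bvec_nth)

lemma Phi0_eq: "Phi0 X Y = X $ 1 * Y $ 2 - X $ 2 * Y $ 1 + X $ 3 * Y $ 4 - X $ 4 * Y $ 3"
  by (simp add: Phi0_def inner_vec_def sum_5 phi0_nth)

lemma Phi0_in_alt2: "(\<lambda>X Y. c * Phi0 X Y) \<in> alt2"
  by (simp add: alt2_iff Phi0_eq algebra_simps)

lemma wedge12_in_alt3:
  assumes "linear \<alpha>" "\<beta> \<in> alt2"
  shows "wedge12 \<alpha> \<beta> \<in> alt3"
proof -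
  have "wedge12 \<alpha> \<beta> X Y Z + wedge12 \<alpha> \<beta> X Z Y = 0" "wedge12 \<alpha> \<beta> X Y Z + wedge12 \<alpha> \<beta> Y X Z = 0" for X Y Z
    using alt2_skew[OF assms(2), of X Y] alt2_skew[OF assms(2), of X Z] alt2_skew[OF assms(2), of Y Z]
    by (simp_all add: wedge12_def)
  moreover have "trilinear (wedge12 \<alpha> \<beta>)"
    unfolding trilinear_iff wedge12_def
    by (simp add: linear_add[OF assms(1)] linear_scale[OF assms(1)] alt2D[OF assms(2)] algebra_simps)
  ultimately show ?thesis by (simp add: alt3_def Aspace_def)
qed

lemma alt3_uminus:
  assumes "A \<in> alt3"
  shows "- A \<in> alt3"
proof -
  have "trilinear A" "A X Y Z + A X Z Y = 0" "A X Y Z + A Y X Z = 0" for X Y Z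
    using assms unfolding alt3_def Aspace_def by blast+
  moreover from this(1) have "trilinear (- A)" by (simp add: trilinear_iff)
  moreover have "- a + - b = 0" if "a + b = 0" for a b :: real using that by simp
  ultimately show ?thesis unfolding alt3_def Aspace_def mem_Collect_eq uminus_apply by blast
qed

lemma linear_flat: "linear (flat v)"
  by (simp add: linear_iff inner_add_right)

lemma wedge12_eta0_in_alt3: "\<alpha> \<in> alt2 \<Longrightarrow> wedge12 eta0 \<alpha> \<in> alt3"
  by (rule wedge12_in_alt3[OF linear_flat])

text \<open>Evaluation on basis vectors turns the definition into linear equations. The wedge
  condition gives that the 12 and 34 coefficients sum to 0, the Hodge condition that they agree, so
  both vanish.\<close>

lemma Lam22_iff:
  "\<alpha> \<in> Lam22 \<longleftrightarrow> \<alpha> \<in> alt2 \<and>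
     \<alpha> (bvec 1) (bvec 2) = 0 \<and> \<alpha> (bvec 3) (bvec 4) = 0 \<and>
     \<alpha> (bvec 2) (bvec 4) = - \<alpha> (bvec 1) (bvec 3) \<and> \<alpha> (bvec 2) (bvec 3) = \<alpha> (bvec 1) (bvec 4) \<and>
     \<alpha> (bvec 5) (bvec 1) = 0 \<and> \<alpha> (bvec 5) (bvec 2) = 0 \<and> \<alpha> (bvec 5) (bvec 3) = 0 \<and> \<alpha> (bvec 5) (bvec 4) = 0"
  (is "_ \<longleftrightarrow> _ \<and> ?c")
proof
  assume L: "\<alpha> \<in> Lam22"
  then have a: "\<alpha> \<in> alt2" and w: "wedge22 Phi0 \<alpha> = 0" and h: "hodge \<alpha> = wedge12 eta0 \<alpha>"
    by (auto simp: Lam22_def)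
  note sort = alt2_bvec_sort[OF a] less_5
  have "wedge22 Phi0 \<alpha> (bvec 1) (bvec 2) (bvec 3) (bvec 4) = 0" using w by simp
  then have "\<alpha> (bvec 1) (bvec 2) + \<alpha> (bvec 3) (bvec 4) = 0"
    by (simp add: wedge22_def Phi0_eq bvec_nth)
  moreover have h': "hodge \<alpha> X Y Z = wedge12 eta0 \<alpha> X Y Z" for X Y Z using h by simp
  note h'[of "bvec 1" "bvec 2" "bvec 3"] h'[of "bvec 1" "bvec 2" "bvec 4"] h'[of "bvec 5" "bvec 1" "bvec 2"]
    h'[of "bvec 1" "bvec 3" "bvec 4"] h'[of "bvec 5" "bvec 1" "bvec 3"] h'[of "bvec 5" "bvec 1" "bvec 4"]
    h'[of "bvec 2" "bvec 3" "bvec 4"]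
  ultimately have ?c
    by (simp add: hodge_bvec wedge12_def flat_bvec bvec_nth sort)
  with a show "\<alpha> \<in> alt2 \<and> ?c" by blast
next
  assume *: "\<alpha> \<in> alt2 \<and> ?c"
  then have a: "\<alpha> \<in> alt2" and c: ?c by blast+
  note sort = alt2_bvec_sort[OF a] less_5
  have "hodge \<alpha> = wedge12 eta0 \<alpha>"
    using hodge_in_alt3 wedge12_eta0_in_alt3[OF a]
    by (rule alt3_eqI)
       (use c in \<open>simp_all add: hodge_bvec wedge12_def flat_bvec bvec_nth sort\<close>)
  moreover have "wedge22 Phi0 \<alpha> = 0"
  proof (intro ext)
    fix X Y Z V
    \<comment> \<open>The coordinates of \<alpha> in the basis e1e3 - e2e4, e1e4 + e2e3 of
      \<open>Lam22\<close>; with them the wedge product becomes a polynomial identity.\<close>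
    define p q where "p = \<alpha> (bvec 1) (bvec 3)" and "q = \<alpha> (bvec 1) (bvec 4)"
    have e: "\<alpha> X Y = p * (X $ 1 * Y $ 3 - X $ 3 * Y $ 1 - X $ 2 * Y $ 4 + X $ 4 * Y $ 2) +
       q * (X $ 1 * Y $ 4 - X $ 4 * Y $ 1 + X $ 2 * Y $ 3 - X $ 3 * Y $ 2)" for X Y
      using fun_cong[OF fun_cong[OF form2_of_self[OF a]], of X Y, symmetric, unfolded form2_of_def sum_less_5] c
      by (simp add: p_def q_def wedge11_def flat_bvec algebra_simps)
    show "wedge22 Phi0 \<alpha> X Y Z V = 0 X Y Z V"
      unfolding wedge22_def Phi0_eq e by (simp add: algebra_simps)
  qed
  ultimately show "\<alpha> \<in> Lam22" using a by (simp add: Lam22_def)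
qed

text \<open>The Hodge equation is evaluated as for \<open>Lam22\<close> with the sign reversed,
  which leaves the 12, 13 and 14 coefficients free.\<close>

lemma Lam23_iff:
  "\<alpha> \<in> Lam23 \<longleftrightarrow> \<alpha> \<in> alt2 \<and>
     \<alpha> (bvec 3) (bvec 4) = - \<alpha> (bvec 1) (bvec 2) \<and>
     \<alpha> (bvec 2) (bvec 4) = \<alpha> (bvec 1) (bvec 3) \<and> \<alpha> (bvec 2) (bvec 3) = - \<alpha> (bvec 1) (bvec 4) \<and>
     \<alpha> (bvec 5) (bvec 1) = 0 \<and> \<alpha> (bvec 5) (bvec 2) = 0 \<and> \<alpha> (bvec 5) (bvec 3) = 0 \<and> \<alpha> (bvec 5) (bvec 4) = 0"
  (is "_ \<longleftrightarrow> _ \<and> ?c")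
proof
  assume L: "\<alpha> \<in> Lam23"
  then have a: "\<alpha> \<in> alt2" and h: "hodge \<alpha> = - wedge12 eta0 \<alpha>"
    by (auto simp: Lam23_def)
  note sort = alt2_bvec_sort[OF a] less_5
  have h': "hodge \<alpha> X Y Z = - wedge12 eta0 \<alpha> X Y Z" for X Y Z using h by simp
  note h'[of "bvec 1" "bvec 2" "bvec 3"] h'[of "bvec 1" "bvec 2" "bvec 4"] h'[of "bvec 5" "bvec 1" "bvec 2"]
    h'[of "bvec 1" "bvec 3" "bvec 4"] h'[of "bvec 5" "bvec 1" "bvec 3"] h'[of "bvec 5" "bvec 1" "bvec 4"]
    h'[of "bvec 2" "bvec 3" "bvec 4"]
  then have ?c
    by (simp add: hodge_bvec wedge12_def flat_bvec bvec_nth sort)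
  with a show "\<alpha> \<in> alt2 \<and> ?c" by blast
next
  assume *: "\<alpha> \<in> alt2 \<and> ?c"
  then have a: "\<alpha> \<in> alt2" and c: ?c by blast+
  note sort = alt2_bvec_sort[OF a] less_5
  have "hodge \<alpha> = - wedge12 eta0 \<alpha>"
    using hodge_in_alt3 alt3_uminus[OF wedge12_eta0_in_alt3[OF a]]
    by (rule alt3_eqI)
       (use c in \<open>simp_all add: hodge_bvec wedge12_def flat_bvec bvec_nth sort\<close>)
  then show "\<alpha> \<in> Lam23" using a by (simp add: Lam23_def)
qed

lemma Lam24_iff:
  "\<alpha> \<in> Lam24 \<longleftrightarrow> \<alpha> \<in> alt2 \<and>
     \<alpha> (bvec 1) (bvec 2) = 0 \<and> \<alpha> (bvec 1) (bvec 3) = 0 \<and> \<alpha> (bvec 1) (bvec 4) = 0 \<and>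
     \<alpha> (bvec 2) (bvec 3) = 0 \<and> \<alpha> (bvec 2) (bvec 4) = 0 \<and> \<alpha> (bvec 3) (bvec 4) = 0"
  (is "_ \<longleftrightarrow> _ \<and> ?c")
proof
  assume L: "\<alpha> \<in> Lam24"
  then have a: "\<alpha> \<in> alt2" and h: "wedge12 eta0 \<alpha> = 0"
    by (auto simp: Lam24_def)
  \<comment> \<open>With \<xi> in the first slot and horizontal Y, Z the wedge product reduces to
    \<alpha>(Y, Z).\<close>
  have h': "wedge12 eta0 \<alpha> xi0 Y Z = 0" for Y Z using h by simp
  note h'[of "bvec 1" "bvec 2"] h'[of "bvec 1" "bvec 3"] h'[of "bvec 1" "bvec 4"]
    h'[of "bvec 2" "bvec 3"] h'[of "bvec 2" "bvec 4"] h'[of "bvec 3" "bvec 4"]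
  then have ?c by (simp add: wedge12_def flat_bvec bvec_nth)
  with a show "\<alpha> \<in> alt2 \<and> ?c" by blast
next
  assume *: "\<alpha> \<in> alt2 \<and> ?c"
  then have a: "\<alpha> \<in> alt2" and c: ?c by blast+
  have z: "0 \<in> alt3" by (simp add: alt3_def Aspace_def trilinear_iff)
  have "wedge12 eta0 \<alpha> = 0"
    using wedge12_eta0_in_alt3[OF a] z
    by (rule alt3_eqI)
       (use c in \<open>simp_all add: wedge12_def flat_bvec bvec_nth alt2_bvec_sort[OF a] less_5\<close>)
  then show "\<alpha> \<in> Lam24" using a by (simp add: Lam24_def)
qed

lemma m_space_iff:
  "\<alpha> \<in> m_space \<longleftrightarrow> \<alpha> \<in> alt2 \<and>
     \<alpha> (bvec 1) (bvec 2) = 0 \<and> \<alpha> (bvec 3) (bvec 4) = 0 \<and>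
     \<alpha> (bvec 2) (bvec 4) = - \<alpha> (bvec 1) (bvec 3) \<and> \<alpha> (bvec 2) (bvec 3) = \<alpha> (bvec 1) (bvec 4)"
  (is "_ \<longleftrightarrow> _ \<and> ?c")
proof
  assume "\<alpha> \<in> m_space"
  then obtain \<beta> \<gamma> where "\<beta> \<in> Lam22" "\<gamma> \<in> Lam24" "\<alpha> = \<beta> + \<gamma>"
    by (auto simp: m_space_def elim: set_plus_elim)
  then show "\<alpha> \<in> alt2 \<and> ?c" by (simp add: Lam22_iff Lam24_iff alt2_add)
next
  assume *: "\<alpha> \<in> alt2 \<and> ?c"
  then have a: "\<alpha> \<in> alt2" and c: ?c by blast+
  \<comment> \<open>The horizontal part of \<alpha> is its \<open>Lam22\<close> component.\<close>
  define \<beta> where "\<beta> = form2_of (\<lambda>i j. if i = 5 then 0 else \<alpha> (bvec i) (bvec j))"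
  have b: "\<beta> \<in> alt2" by (simp add: \<beta>_def form2_of_in_alt2)
  have "\<beta> \<in> Lam22" using c by (simp add: Lam22_iff b) (simp add: \<beta>_def form2_of_bvec less_5)
  moreover have "\<alpha> - \<beta> \<in> Lam24"
    by (simp add: Lam24_iff alt2_diff[OF a b]) (simp add: \<beta>_def form2_of_bvec less_5)
  ultimately have "\<beta> + (\<alpha> - \<beta>) \<in> m_space" unfolding m_space_def by (rule set_plus_intro)
  then show "\<alpha> \<in> m_space" by simp
qed

section \<open>The orthogonal projection to m\<close>

lemma inner2_diff: "inner2 (\<alpha> - \<beta>) \<gamma> = inner2 \<alpha> \<gamma> - inner2 \<beta> \<gamma>"
  by (simp add: inner2_def sum_less_5 left_diff_distrib)

text \<open>On horizontal vectors the projection is the \<open>phi0\<close>-anti-invariant part.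
  Since \<open>phi0\<close> kills \<xi>, that expression keeps only half of \<beta>(\<xi>, .), and
  the last two terms restore the other half.\<close>

lemma pr_m_eq:
  assumes b: "\<beta> \<in> alt2"
  shows "pr_m \<beta> = (\<lambda>Y Z. (\<beta> Y Z - \<beta> (phi0 Y) (phi0 Z) + Y $ 5 * \<beta> xi0 Z + Z $ 5 * \<beta> Y xi0) / 2)"
    (is "_ = ?\<gamma>")
  unfolding pr_m_def
proof (rule the_equality)
  have g: "?\<gamma> \<in> alt2"
  proof (rule alt2I)
    fix X Y
    show "?\<gamma> X Y + ?\<gamma> Y X = 0"
      using alt2_skew[OF b, of X Y] alt2_skew[OF b, of "phi0 X" "phi0 Y"] alt2_skew[OF b, of X xi0]
        alt2_skew[OF b, of Y xi0]
      by (simp add: field_simps)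
  qed (simp_all add: alt2D[OF b] phi0_linear field_simps)
  have gm: "?\<gamma> \<in> m_space"
    unfolding m_space_iff using g
    by (simp add: bvec_nth phi0_bvec alt2D[OF b] alt2_bvec_sort[OF b] less_5 field_simps)
  have orth: "inner2 (\<beta> - ?\<gamma>) \<delta> = 0" if "\<delta> \<in> m_space" for \<delta>
    using that unfolding inner2_def sum_less_5 m_space_iff
    by (simp add: bvec_nth phi0_bvec alt2D[OF b] alt2_bvec_sort[OF b] less_5 field_simps)
  show "?\<gamma> \<in> m_space \<and> (\<forall>\<delta>\<in>m_space. inner2 (\<beta> - ?\<gamma>) \<delta> = 0)" using gm orth by blast
  fix \<gamma>
  assume *: "\<gamma> \<in> m_space \<and> (\<forall>\<delta>\<in>m_space. inner2 (\<beta> - \<gamma>) \<delta> = 0)"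
  \<comment> \<open>The difference of two candidates lies in m and is orthogonal to m; its norm is a
    sum of squares equal to 0.\<close>
  define \<delta> where "\<delta> = ?\<gamma> - \<gamma>"
  have d: "\<delta> \<in> m_space" using gm * unfolding \<delta>_def m_space_iff by (simp add: alt2_diff)
  have "inner2 (?\<gamma> - \<gamma>) \<delta> = inner2 (\<beta> - \<gamma>) \<delta> - inner2 (\<beta> - ?\<gamma>) \<delta>"
    unfolding inner2_diff by argo
  then have "inner2 \<delta> \<delta> = inner2 (\<beta> - \<gamma>) \<delta> - inner2 (\<beta> - ?\<gamma>) \<delta>"
    by (simp only: \<delta>_def)
  also have "\<dots> = 0" using * orth d by simp
  finally have "(\<Sum>p\<in>{(i, j). i < j}. (\<delta> (bvec (fst p)) (bvec (snd p)))\<^sup>2) = 0"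
    by (simp add: inner2_def case_prod_beta power2_eq_square)
  then have "\<forall>p\<in>{(i, j). i < j}. (\<delta> (bvec (fst p)) (bvec (snd p)))\<^sup>2 = 0"
    by (subst (asm) sum_nonneg_eq_0_iff) auto
  then have "\<delta> (bvec i) (bvec j) = 0" if "i < j" for i j using that by auto
  then have "form2_of (\<lambda>i j. \<delta> (bvec i) (bvec j)) = 0"
    by (auto simp: form2_of_def fun_eq_iff intro!: sum.neutral)
  with d have "\<delta> = 0" by (simp add: form2_of_self m_space_iff)
  then show "\<gamma> = ?\<gamma>" by (simp add: \<delta>_def)
qed

section \<open>The projection to W and three-forms\<close>

lemma Aspace_iff: "A \<in> Aspace \<longleftrightarrow> trilinear A \<and> (\<forall>X Y Z. A X Y Z + A X Z Y = 0)"
  by (simp add: Aspace_def)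

text \<open>Here A is viewed as a linear map from vectors to 2-forms, so that the facts on
  \<open>alt2\<close> apply to each \<open>A X\<close>.\<close>

lemma AspaceI:
  assumes "\<And>X X' Y Z. A (X + X') Y Z = A X Y Z + A X' Y Z"
    "\<And>X Y Z a. A (a *\<^sub>R X) Y Z = a * A X Y Z"
    "\<And>X. A X \<in> alt2"
  shows "A \<in> Aspace"
proof -
  have "trilinear A"
    unfolding trilinear_iff by (intro conjI allI) (rule assms(1,2) alt2D[OF assms(3)])+
  moreover have "A X Y Z + A X Z Y = 0" for X Y Z
    using alt2_skew[OF assms(3), of X Y Z] by simp
  ultimately show ?thesis unfolding Aspace_iff by blast
qed

lemma AspaceD:
  assumes "A \<in> Aspace"
  shows "A (X + X') Y Z = A X Y Z + A X' Y Z" "A (a *\<^sub>R X) Y Z = a * A X Y Z"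
    "A (- X) Y Z = - A X Y Z" "A (X - X') Y Z = A X Y Z - A X' Y Z" "A 0 Y Z = 0" "A X \<in> alt2"
proof -
  have tri: "trilinear A" and skew: "\<And>X Y Z. A X Y Z + A X Z Y = 0"
    using assms unfolding Aspace_iff by blast+
  then have l: "linear (\<lambda>X. A X Y Z)" for Y Z unfolding trilinear_def by blast
  show "A (X + X') Y Z = A X Y Z + A X' Y Z" "A (a *\<^sub>R X) Y Z = a * A X Y Z"
    "A (- X) Y Z = - A X Y Z" "A (X - X') Y Z = A X Y Z - A X' Y Z" "A 0 Y Z = 0"
    using linear_add[OF l] linear_scale[OF l] linear_neg[OF l] linear_diff[OF l] linear_0[OF l]
    by simp_all
  show "A X \<in> alt2"
    using tri[unfolded trilinear_iff] skew by (intro alt2I) blast+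
qed

lemmas Aspace_simps = AspaceD(1-5) alt2D[OF AspaceD(6)]

lemma Aspace_skew: "A \<in> Aspace \<Longrightarrow> A X Y Z = - A X Z Y"
  by (rule alt2_skew[OF AspaceD(6)])

lemma Aspace_sort: "A \<in> Aspace \<Longrightarrow> j < i \<Longrightarrow> A X (bvec i) (bvec j) = - A X (bvec j) (bvec i)"
  by (rule Aspace_skew)

lemma Aspace_add: "A \<in> Aspace \<Longrightarrow> B \<in> Aspace \<Longrightarrow> A + B \<in> Aspace"
  by (rule AspaceI) (simp_all add: AspaceD alt2_add distrib_left)

lemma Aspace_diff: "A \<in> Aspace \<Longrightarrow> B \<in> Aspace \<Longrightarrow> A - B \<in> Aspace"
  by (rule AspaceI) (simp_all add: AspaceD alt2_diff right_diff_distrib)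

lemma alt3_Aspace: "A \<in> alt3 \<Longrightarrow> A \<in> Aspace"
  by (simp add: alt3_def)

lemma pr_W_eq:
  assumes "A \<in> Aspace"
  shows "pr_W A X Y Z = (A X Y Z - A X (phi0 Y) (phi0 Z) + Y $ 5 * A X xi0 Z + Z $ 5 * A X Y xi0) / 2"
  by (simp add: pr_W_def pr_m_eq[OF AspaceD(6)[OF assms]])

lemma pr_W_in_Aspace:
  assumes A: "A \<in> Aspace"
  shows "pr_W A \<in> Aspace"
proof (rule AspaceI)
  fix X
  show "pr_W A X \<in> alt2"
  proof (rule alt2I)
    fix Y Z
    show "pr_W A X Y Z + pr_W A X Z Y = 0"
      using Aspace_skew[OF A, of X Y Z] Aspace_skew[OF A, of X "phi0 Y" "phi0 Z"]
        Aspace_skew[OF A, of X xi0 Z] Aspace_skew[OF A, of X xi0 Y]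
      by (simp add: pr_W_eq[OF A] field_simps)
  qed (simp_all add: pr_W_eq[OF A] Aspace_simps[OF A] phi0_linear field_simps)
qed (simp_all add: pr_W_eq[OF A] Aspace_simps[OF A] field_simps)

lemma pr_W_add: "A \<in> Aspace \<Longrightarrow> B \<in> Aspace \<Longrightarrow> pr_W (A + B) = pr_W A + pr_W B"
  by (simp add: fun_eq_iff pr_W_eq Aspace_add field_simps)

lemma pr_W_bvec:
  assumes A: "A \<in> Aspace"
  shows "pr_W A X (bvec 1) (bvec 2) = 0" "pr_W A X (bvec 3) (bvec 4) = 0"
    "pr_W A X (bvec 1) (bvec 3) = (A X (bvec 1) (bvec 3) - A X (bvec 2) (bvec 4)) / 2"
    "pr_W A X (bvec 2) (bvec 4) = - (A X (bvec 1) (bvec 3) - A X (bvec 2) (bvec 4)) / 2"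
    "pr_W A X (bvec 1) (bvec 4) = (A X (bvec 1) (bvec 4) + A X (bvec 2) (bvec 3)) / 2"
    "pr_W A X (bvec 2) (bvec 3) = (A X (bvec 1) (bvec 4) + A X (bvec 2) (bvec 3)) / 2"
    "pr_W A X (bvec 5) (bvec 1) = A X (bvec 5) (bvec 1)"
    "pr_W A X (bvec 5) (bvec 2) = A X (bvec 5) (bvec 2)"
    "pr_W A X (bvec 5) (bvec 3) = A X (bvec 5) (bvec 3)"
    "pr_W A X (bvec 5) (bvec 4) = A X (bvec 5) (bvec 4)"
  by (simp_all add: pr_W_eq[OF A] phi0_bvec bvec_nth Aspace_simps[OF A] Aspace_sort[OF A] less_5)

text \<open>\<open>theta2\<close> merely expands the first argument in the basis, so on 3-forms it
  is the inclusion into the tensors.\<close>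

lemma theta2_trilinear:
  assumes "trilinear A"
  shows "theta2 A = A"
proof (intro ext)
  fix X Y Z
  have l: "linear (\<lambda>X. A X Y Z)" using assms by (simp add: trilinear_def)
  have "A (\<Sum>i\<in>UNIV. X $ i *\<^sub>R bvec i) Y Z = (\<Sum>i\<in>UNIV. X $ i * A (bvec i) Y Z)"
    using linear_sum[OF l, of "\<lambda>i. X $ i *\<^sub>R bvec i" UNIV] linear_scale[OF l] by simp
  moreover have "(\<Sum>i\<in>UNIV. X $ i *\<^sub>R bvec i) = X"
    using basis_expansion[of X] by (simp add: scalar_mult_eq_scaleR)
  ultimately show "theta2 A X Y Z = A X Y Z" by (simp add: theta2_def flat_bvec)
qed

lemma theta2_hodge: "theta2 (hodge \<alpha>) = hodge \<alpha>"
  using hodge_in_alt3[of \<alpha>] by (simp add: theta2_trilinear alt3_def Aspace_def)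

lemma hodge_in_Aspace: "hodge \<alpha> \<in> Aspace"
  using hodge_in_alt3 by (rule alt3_Aspace)

lemma hodge_add: "hodge (\<alpha> + \<beta>) = hodge \<alpha> + hodge \<beta>"
  by (simp add: fun_eq_iff hodge_def sum_less_5 algebra_simps)

lemma theta1_in_Aspace: "\<alpha> \<in> alt1 \<Longrightarrow> theta1 \<alpha> \<in> Aspace"
  by (intro AspaceI alt2I)
     (simp_all add: theta1_def alt1_def linear_add linear_scale inner_add_left inner_add_right algebra_simps)

lemma flat_in_alt1: "(\<lambda>X. c * flat v X) \<in> alt1"
  by (simp add: alt1_def linear_iff inner_add_right algebra_simps)

text \<open>The form \<alpha> splits into a multiple of \<eta> and a horizontal part.
  \<open>W1\<close> is defined without projection, so \<open>theta1\<close> of the first part must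
  be shown to be fixed by \<open>pr_W\<close>.\<close>

lemma pr_W_theta1:
  assumes "\<alpha> \<in> alt1"
  shows "pr_W (theta1 \<alpha>) \<in> W1 + W2"
proof -
  define \<alpha>1 where "\<alpha>1 = (\<lambda>X. \<alpha> xi0 * eta0 X)"
  define \<alpha>2 where "\<alpha>2 = \<alpha> - \<alpha>1"
  have l1: "\<alpha>1 \<in> alt1" unfolding \<alpha>1_def by (rule flat_in_alt1)
  have l2: "\<alpha>2 \<in> alt1" using assms l1 unfolding \<alpha>2_def alt1_def fun_diff_def
    by (simp add: linear_compose_sub)
  have "pr_W (theta1 \<alpha>1) = theta1 \<alpha>1"
    by (simp add: fun_eq_iff pr_W_eq theta1_in_Aspace l1)
       (simp add: theta1_def \<alpha>1_def flat_bvec phi0_nth bvec_nth inner_axis algebra_simps)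
  moreover have "\<alpha>1 \<in> Lam11" by (auto simp: Lam11_def \<alpha>1_def)
  ultimately have "pr_W (theta1 \<alpha>1) \<in> W1" by (simp add: W1_def)
  moreover have "\<alpha>2 \<in> Lam12" using l2 by (simp add: Lam12_def \<alpha>2_def \<alpha>1_def flat_bvec bvec_nth)
  then have "pr_W (theta1 \<alpha>2) \<in> W2" by (simp add: W2_def)
  moreover have "theta1 \<alpha> = theta1 \<alpha>1 + theta1 \<alpha>2"
    by (simp add: fun_eq_iff theta1_def \<alpha>2_def algebra_simps)
  then have "pr_W (theta1 \<alpha>) = pr_W (theta1 \<alpha>1) + pr_W (theta1 \<alpha>2)"
    using l1 l2 by (simp add: pr_W_add theta1_in_Aspace)
  ultimately show ?thesis by (metis set_plus_intro)
qed

text \<open>The terms with \<eta> form \<alpha>4 and the horizontal anti-invariant part is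
  \<alpha>2. The invariant part splits into its multiple \<alpha>1 of \<open>Phi0\<close>, with c
  the mean of the 12 and 34 coefficients, and the rest \<alpha>3.\<close>

lemma alt2_decomp:
  assumes a: "\<alpha> \<in> alt2"
  obtains \<alpha>1 \<alpha>2 \<alpha>3 \<alpha>4 where "\<alpha>1 \<in> Lam21" "\<alpha>2 \<in> Lam22" "\<alpha>3 \<in> Lam23" "\<alpha>4 \<in> Lam24"
    "\<alpha> = \<alpha>1 + \<alpha>2 + \<alpha>3 + \<alpha>4"
proof -
  define c where "c = (\<alpha> (bvec 1) (bvec 2) + \<alpha> (bvec 3) (bvec 4)) / 2"
  define \<alpha>1 where "\<alpha>1 = (\<lambda>X Y. c * Phi0 X Y)"
  define \<alpha>2 where "\<alpha>2 = form2_of (\<lambda>i j. if i = 5 then 0 else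
    (\<alpha> (bvec i) (bvec j) - \<alpha> (phi0 (bvec i)) (phi0 (bvec j))) / 2)"
  define \<alpha>3 where "\<alpha>3 = form2_of (\<lambda>i j. if i = 5 then 0 else
    (\<alpha> (bvec i) (bvec j) + \<alpha> (phi0 (bvec i)) (phi0 (bvec j))) / 2 - c * Phi0 (bvec i) (bvec j))"
  define \<alpha>4 where "\<alpha>4 = form2_of (\<lambda>i j. if i = 5 then \<alpha> (bvec i) (bvec j) else 0)"
  have a1: "\<alpha>1 \<in> alt2" unfolding \<alpha>1_def by (rule Phi0_in_alt2)
  have a234: "\<alpha>2 \<in> alt2" "\<alpha>3 \<in> alt2" "\<alpha>4 \<in> alt2"
    by (simp_all add: \<alpha>2_def \<alpha>3_def \<alpha>4_def form2_of_in_alt2)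
  note eval = form2_of_bvec less_5 phi0_bvec alt2D[OF a] alt2_bvec_sort[OF a] Phi0_eq bvec_nth
  have "\<alpha>1 \<in> Lam21" by (auto simp: Lam21_def \<alpha>1_def)
  moreover have "\<alpha>2 \<in> Lam22"
    by (simp add: Lam22_iff a234) (simp add: \<alpha>2_def eval field_simps)
  moreover have "\<alpha>3 \<in> Lam23"
    by (simp add: Lam23_iff a234) (simp add: \<alpha>3_def c_def eval field_simps)
  moreover have "\<alpha>4 \<in> Lam24"
    by (simp add: Lam24_iff a234) (simp add: \<alpha>4_def eval)
  moreover have "\<alpha> = \<alpha>1 + \<alpha>2 + \<alpha>3 + \<alpha>4"
    by (rule alt2_eqI)
       (simp_all add: a a1 a234 alt2_add, simp_all add: \<alpha>1_def \<alpha>2_def \<alpha>3_def \<alpha>4_def c_def eval field_simps)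
  ultimately show ?thesis by (rule that)
qed

lemma hodge_surj:
  assumes "S \<in> alt3"
  obtains \<alpha> where "\<alpha> \<in> alt2" "hodge \<alpha> = S"
proof
  let ?S = "\<lambda>i j k. S (bvec i) (bvec j) (bvec k)"
  \<comment> \<open>This reads the table \<open>hodge_bvec\<close> backwards; the last line is the
    case \<open>i = 5\<close>.\<close>
  define \<alpha> where "\<alpha> = form2_of (\<lambda>i j.
     if i = 1 then (if j = 2 then ?S 5 3 4 else if j = 3 then - ?S 5 2 4 else ?S 5 2 3)
     else if i = 2 then (if j = 3 then ?S 5 1 4 else - ?S 5 1 3)
     else if i = 3 then ?S 5 1 2
     else if j = 1 then ?S 2 3 4 else if j = 2 then - ?S 1 3 4 else if j = 3 then ?S 1 2 4 else - ?S 1 2 3)"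
  show "\<alpha> \<in> alt2" by (simp add: \<alpha>_def form2_of_in_alt2)
  show "hodge \<alpha> = S"
    using hodge_in_alt3 assms
    by (rule alt3_eqI) (simp_all add: hodge_bvec \<alpha>_def form2_of_bvec less_5)
qed

text \<open>Here the Hodge dual is the wedge product of \<eta> with \<alpha>: inserting \<xi> leaves
  \<alpha> itself, inserting a horizontal vector leaves a form divisible by \<eta>, and both lie in
  m. Hence \<open>W4\<close> needs no projection.\<close>

lemma pr_W_hodge_Lam22:
  assumes "\<alpha> \<in> Lam22"
  shows "pr_W (hodge \<alpha>) = hodge \<alpha>"
proof -
  have a: "\<alpha> \<in> alt2" and h: "hodge \<alpha> = wedge12 eta0 \<alpha>"
    using assms by (auto simp: Lam22_def)
  have w: "wedge12 eta0 \<alpha> \<in> Aspace" using hodge_in_Aspace[of \<alpha>] by (simp add: h)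
  show ?thesis
    unfolding h
    by (rule Aspace_eqI, rule pr_W_in_Aspace[OF w], rule w)
       (use assms in \<open>simp_all add: pr_W_bvec[OF w] forall_5 wedge12_def flat_bvec bvec_nth
          Lam22_iff alt2D[OF a] alt2_bvec_sort[OF a] less_5\<close>)
qed

lemma pr_W_alt3:
  assumes "S \<in> alt3"
  shows "pr_W S \<in> W3 + W4 + W5 + W6"
proof -
  obtain \<alpha> where a: "\<alpha> \<in> alt2" and S: "hodge \<alpha> = S" using hodge_surj[OF assms] .
  obtain \<alpha>1 \<alpha>2 \<alpha>3 \<alpha>4 where m: "\<alpha>1 \<in> Lam21" "\<alpha>2 \<in> Lam22" "\<alpha>3 \<in> Lam23" "\<alpha>4 \<in> Lam24"
    and e: "\<alpha> = \<alpha>1 + \<alpha>2 + \<alpha>3 + \<alpha>4" using alt2_decomp[OF a] .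
  have "pr_W S = pr_W (hodge \<alpha>1) + hodge \<alpha>2 + pr_W (hodge \<alpha>3) + pr_W (hodge \<alpha>4)"
    by (simp add: S[symmetric] e hodge_add pr_W_add hodge_in_Aspace Aspace_add pr_W_hodge_Lam22 m)
  moreover have "pr_W (hodge \<alpha>1) \<in> W3" "hodge \<alpha>2 \<in> W4" "pr_W (hodge \<alpha>3) \<in> W5" "pr_W (hodge \<alpha>4) \<in> W6"
    using m by (auto simp: W3_def W4_def W5_def W6_def Lam31_def Lam32_def Lam33_def Lam34_def
        image_image theta2_hodge)
  ultimately show ?thesis by (auto intro!: set_plus_intro)
qed

section \<open>The projection of traceless cyclic tensors\<close>

text \<open>For fixed X this is the wedge product of \<eta> with h(X, .), hence the way to place a
  bilinear form into the part of the tensors with values in \<open>Lam24\<close>.\<close>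

definition sym_tensor :: "form2 \<Rightarrow> form3" where
  "sym_tensor h X Y Z = Y $ 5 * h X Z - Z $ 5 * h X Y"

lemma sym_tensor_in_Aspace:
  assumes "bilinear h"
  shows "sym_tensor h \<in> Aspace"
  using assms unfolding bilinear_iff linear_iff
  by (intro AspaceI alt2I) (simp_all add: sym_tensor_def algebra_simps)

text \<open>Symmetry makes the cyclic sum cancel; the trace is h(\<xi>, X) minus \<eta>(X) times the
  trace of h.\<close>

lemma sym_tensor_in_A3:
  assumes "bilinear h" and "\<And>X Y. h X Y = h Y X" and "\<And>X. h xi0 X = 0"
    and "(\<Sum>i\<in>UNIV. h (bvec i) (bvec i)) = 0"
  shows "sym_tensor h \<in> A3"
proof -
  have "sym_tensor h X Y Z + sym_tensor h Y Z X + sym_tensor h Z X Y = 0" for X Y Z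
    using assms(2)[of X Y] assms(2)[of X Z] assms(2)[of Y Z] by (simp add: sym_tensor_def)
  moreover have "(\<Sum>i\<in>UNIV. sym_tensor h (bvec i) (bvec i) X) = 0" for X
  proof -
    have "(\<Sum>i\<in>UNIV. sym_tensor h (bvec i) (bvec i) X) = h xi0 X - X $ 5 * (\<Sum>i\<in>UNIV. h (bvec i) (bvec i))"
      by (simp add: sym_tensor_def sum_5 bvec_nth algebra_simps)
    then show ?thesis using assms(3,4) by simp
  qed
  ultimately show ?thesis
    using sym_tensor_in_Aspace[OF assms(1)] unfolding A3_def by blast
qed

lemma sym_tensor_mem:
  assumes b: "bilinear h" and s: "\<And>X Y. h X Y = h Y X" and z: "\<And>X. h xi0 X = 0"
    and t: "(\<Sum>i\<in>UNIV. h (bvec i) (bvec i)) = 0"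
  shows "sym_tensor h \<in> W8 + W10"
proof -
  \<comment> \<open>The square of \<open>phi0\<close> is minus the horizontal projection, and h
    ignores \<xi>.\<close>
  have phi_phi: "h (phi0 (phi0 X)) Y = - h X Y" "h X (phi0 (phi0 Y)) = - h X Y" for X Y
  proof -
    have e: "phi0 (phi0 X) = (X $ 5) *\<^sub>R xi0 - X" for X
      by (simp add: vec_eq_iff forall_5 phi0_nth bvec_nth)
    show *: "h (phi0 (phi0 X)) Y = - h X Y" for X Y
      unfolding e using z b by (simp add: bilinear_lsub bilinear_lmul)
    show "h X (phi0 (phi0 Y)) = - h X Y" using *[of Y X] s by metis
  qed
  \<comment> \<open>For c = 1 and c = -1 these are the invariant and anti-invariant parts of h. On a
    \<open>sym_tensor\<close> the identities defining \<open>W8\<close> and \<open>W10\<close> say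
    precisely that h(\<open>phi0 X\<close>, \<open>phi0 Y\<close>) is h(X, Y), respectively -h(X,
    Y).\<close>
  define k where "k c X Y = (h X Y + c * h (phi0 X) (phi0 Y)) / 2" for c X Y
  have k: "sym_tensor (k c) \<in> A3" if "c = 1 \<or> c = -1" for c
  proof (rule sym_tensor_in_A3)
    show "bilinear (k c)"
      using b unfolding bilinear_iff linear_iff by (simp add: k_def phi0_linear field_simps)
    show "k c X Y = k c Y X" for X Y
      using s[of X Y] s[of "phi0 X" "phi0 Y"] by (simp add: k_def)
    show "k c xi0 X = 0" for X
      using z b by (simp add: k_def phi0_bvec bilinear_lzero)
    show "(\<Sum>i\<in>UNIV. k c (bvec i) (bvec i)) = 0"
    proof -
      \<comment> \<open>\<open>phi0\<close> permutes the horizontal basis up to sign, so it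
        preserves the trace of h.\<close>
      have "(\<Sum>i\<in>UNIV. k c (bvec i) (bvec i)) = (1 + c) / 2 * (\<Sum>i\<in>UNIV. h (bvec i) (bvec i))"
        using z b by (simp add: k_def sum_5 phi0_bvec bilinear_lzero bilinear_lneg bilinear_rneg field_simps)
      then show ?thesis using t by simp
    qed
  qed
  have "sym_tensor (k 1) \<in> W8" "sym_tensor (k (-1)) \<in> W10"
    using k[of 1] k[of "-1"]
    by (auto simp: W8_def W10_def sym_tensor_def k_def phi0_nth phi_phi bilinear_lneg[OF b] bilinear_rneg[OF b] field_simps)
  moreover have "sym_tensor h = sym_tensor (k 1) + sym_tensor (k (-1))"
    by (simp add: fun_eq_iff sym_tensor_def k_def field_simps)
  ultimately show ?thesis by (metis set_plus_intro)
qed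

text \<open>The general element of \<open>\<Lambda>\<^sup>1\<^sub>2 \<otimes> \<Lambda>\<^sup>2\<^sub>2\<close> when \<open>u\<close> and \<open>v\<close> are horizontal: \<open>\<Lambda>\<^sup>2\<^sub>2\<close> is spanned by
  \<open>e\<^sub>1 \<and> e\<^sub>3 - e\<^sub>2 \<and> e\<^sub>4\<close> and \<open>e\<^sub>1 \<and> e\<^sub>4 + e\<^sub>2 \<and> e\<^sub>3\<close>. The summands W6 and W9 are cut out by
  \<open>v = - phi0 u\<close> and \<open>v = phi0 u\<close>.\<close>

definition mixed_tensor :: "vec5 \<Rightarrow> vec5 \<Rightarrow> form3" where
  "mixed_tensor u v X Y Z =
     (u \<bullet> X) * (Y $ 1 * Z $ 3 - Y $ 3 * Z $ 1 - Y $ 2 * Z $ 4 + Y $ 4 * Z $ 2) +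
     (v \<bullet> X) * (Y $ 1 * Z $ 4 - Y $ 4 * Z $ 1 + Y $ 2 * Z $ 3 - Y $ 3 * Z $ 2)"

lemma mixed_tensor_in_Aspace: "mixed_tensor u v \<in> Aspace"
  by (intro AspaceI alt2I) (simp_all add: mixed_tensor_def inner_add_right algebra_simps)

text \<open>The relation between the two coefficient vectors serves cyclicity and the trace
  condition; anti-invariance in the last two slots comes from the two basis forms of
  \<open>Lam22\<close>.\<close>

lemma mixed_tensor_in_W9:
  assumes "p $ 5 = 0"
  shows "mixed_tensor p (phi0 p) \<in> W9"
proof -
  have "mixed_tensor p (phi0 p) X Y Z + mixed_tensor p (phi0 p) Y Z X + mixed_tensor p (phi0 p) Z X Y = 0" for X Y Z
    using assms by (simp add: mixed_tensor_def inner_vec_def sum_5 phi0_nth algebra_simps)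
  moreover have "(\<Sum>i\<in>UNIV. mixed_tensor p (phi0 p) (bvec i) (bvec i) X) = 0" for X
    using assms by (simp add: mixed_tensor_def inner_vec_def sum_5 phi0_nth bvec_nth algebra_simps)
  moreover have "mixed_tensor p (phi0 p) X Y Z = - mixed_tensor p (phi0 p) X (phi0 Y) (phi0 Z)" for X Y Z
    by (simp add: mixed_tensor_def phi0_nth algebra_simps)
  ultimately show ?thesis
    using mixed_tensor_in_Aspace unfolding W9_def A3_def by blast
qed

lemma mixed_tensor_in_W6:
  assumes "p $ 5 = 0"
  shows "mixed_tensor p (- phi0 p) \<in> W6"
proof -
  \<comment> \<open>Found by comparing \<open>pr_W_bvec\<close> and \<open>hodge_bvec\<close> with
    the target; the factor 2 offsets the half in the projection.\<close>
  define \<beta> where "\<beta> = form2_of (\<lambda>i j. if i \<noteq> 5 then 0 else if j = 1 then 2 * p $ 3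
     else if j = 2 then - 2 * p $ 4 else if j = 3 then - 2 * p $ 1 else 2 * p $ 2)"
  have b: "\<beta> \<in> Lam24" by (simp add: Lam24_iff \<beta>_def form2_of_in_alt2 form2_of_bvec less_5)
  have "pr_W (hodge \<beta>) = mixed_tensor p (- phi0 p)"
    by (rule Aspace_eqI)
       (simp_all add: hodge_in_Aspace pr_W_in_Aspace mixed_tensor_in_Aspace pr_W_bvec forall_5 mixed_tensor_def
         inner_axis phi0_nth bvec_nth assms hodge_bvec alt3_bvec_sort[OF hodge_in_alt3] alt3_diag[OF hodge_in_alt3]
         \<beta>_def form2_of_bvec less_5 field_simps)
  then show ?thesis using b by (force simp: W6_def Lam34_def theta2_hodge)
qed

lemma mixed_tensor_mem:
  assumes "u $ 5 = 0" "v $ 5 = 0"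
  shows "mixed_tensor u v \<in> W6 + W9"
proof -
  \<comment> \<open>p6 and p9 solve p6 + p9 = u and \<open>phi0 (p9 - p6)\<close> = v, because
    \<open>phi0\<close> squares to -1 on horizontal vectors.\<close>
  define p6 where "p6 = (1/2) *\<^sub>R (u + phi0 v)"
  define p9 where "p9 = (1/2) *\<^sub>R (u - phi0 v)"
  have "mixed_tensor u v = mixed_tensor p6 (- phi0 p6) + mixed_tensor p9 (phi0 p9)"
    using assms by (simp add: fun_eq_iff mixed_tensor_def p6_def p9_def inner_vec_def sum_5 phi0_nth field_simps)
  moreover have "mixed_tensor p6 (- phi0 p6) \<in> W6" "mixed_tensor p9 (phi0 p9) \<in> W9"
    using assms by (auto intro!: mixed_tensor_in_W6 mixed_tensor_in_W9 simp: p6_def p9_def phi0_nth)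
  ultimately show ?thesis by (metis set_plus_intro)
qed


text \<open>The wedge product contains one copy of \<eta>(X) \<alpha>(Y, Z), so two of the three
  remain.\<close>

lemma theta3_eq:
  assumes "\<alpha> \<in> alt2"
  shows "theta3 \<alpha> X Y Z = 2 * X $ 5 * \<alpha> Y Z - Y $ 5 * \<alpha> Z X - Z $ 5 * \<alpha> X Y"
proof -
  have "trilinear (wedge12 eta0 \<alpha>)"
    using wedge12_eta0_in_alt3[OF assms] by (simp add: alt3_def Aspace_iff)
  then show ?thesis by (simp add: theta3_def theta2_trilinear wedge12_def flat_bvec)
qed

lemma theta3_in_Aspace:
  assumes "\<alpha> \<in> alt2"
  shows "theta3 \<alpha> \<in> Aspace"
proof (intro AspaceI alt2I)
  fix X Y Z
  show "theta3 \<alpha> X Y Z + theta3 \<alpha> X Z Y = 0"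
    using alt2_skew[OF assms, of X Y] alt2_skew[OF assms, of X Z] alt2_skew[OF assms, of Y Z]
    by (simp add: theta3_eq[OF assms])
qed (simp_all add: theta3_eq[OF assms] alt2D[OF assms] algebra_simps)

lemma pr_W_A3:
  assumes "S \<in> A3"
  shows "pr_W S \<in> W2 + W3 + W5 + W6 + W7 + W8 + W9 + W10"
proof -
  let ?S = "\<lambda>i j k. S (bvec i) (bvec j) (bvec k)"
  have S: "S \<in> Aspace" and cyc: "\<And>X Y Z. S X Y Z + S Y Z X + S Z X Y = 0"
    and tr: "\<And>X. (\<Sum>i\<in>UNIV. S (bvec i) (bvec i) X) = 0"
    using assms unfolding A3_def by blast+
  \<comment> \<open>In the decomposition below only \<open>theta1 t\<close> contributes to the
    values at (\<xi>, \<xi>, .).\<close>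
  define t where "t = S xi0 xi0"
  have t1: "t \<in> alt1"
    using alt2D(6,9)[OF AspaceD(6)[OF S]] by (simp add: t_def alt1_def linear_iff)
  then have t: "t \<in> Lam12" by (simp add: Lam12_def t_def Aspace_simps[OF S])
  have t_bvec: "t (bvec j) = ?S 5 5 j" for j by (simp add: t_def)
  note T = theta1_in_Aspace[OF t1]
  \<comment> \<open>Applying \<open>phi0\<close> twice is minus the horizontal projection; the two
    signs cancel.\<close>
  define s where "s X Z = S (phi0 (phi0 X)) xi0 (phi0 (phi0 Z))" for X Z
  have s_bvec: "s (bvec i) (bvec j) = (if i = 5 \<or> j = 5 then 0 else ?S i 5 j)" for i j
    using exhaust_5[of i] exhaust_5[of j] by (auto simp: s_def phi0_bvec phi0_0 phi0_uminus Aspace_simps[OF S])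
  have s: "bilinear s"
    by (simp add: bilinear_iff linear_iff s_def phi0_linear Aspace_simps[OF S])
  define K where "K = form2_of (\<lambda>i j. (s (bvec i) (bvec j) - s (bvec j) (bvec i)) / 2)"
  define h where "h X Z = (s X Z + s Z X) / 2" for X Z
  have hb: "bilinear h"
    using s unfolding bilinear_iff linear_iff by (simp add: h_def field_simps)
  have h: "sym_tensor h \<in> W8 + W10"
  proof (rule sym_tensor_mem[OF hb])
    show "h X Y = h Y X" for X Y by (simp add: h_def)
    show "h xi0 X = 0" for X by (simp add: h_def s_def phi0_bvec phi0_0 Aspace_simps[OF S])
    show "(\<Sum>i\<in>UNIV. h (bvec i) (bvec i)) = 0"
      \<comment> \<open>The trace condition at \<xi> has no contribution from i = 5 and so says that
        s is traceless.\<close>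
      using tr[of xi0] Aspace_skew[OF S, of "bvec 1" "bvec 1" xi0] Aspace_skew[OF S, of "bvec 2" "bvec 2" xi0]
        Aspace_skew[OF S, of "bvec 3" "bvec 3" xi0] Aspace_skew[OF S, of "bvec 4" "bvec 4" xi0]
      by (simp add: sum_5 h_def s_bvec Aspace_simps[OF S])
  qed
  obtain k1 k2 k3 k4 where k: "k1 \<in> Lam21" "k2 \<in> Lam22" "k3 \<in> Lam23" "k4 \<in> Lam24"
    and K: "K = k1 + k2 + k3 + k4"
    using alt2_decomp[of K] form2_of_in_alt2 unfolding K_def by blast
  obtain c where c: "k1 = (\<lambda>X Y. c * Phi0 X Y)" using k(1) unfolding Lam21_def by blast
  \<comment> \<open>The Hodge operator is the wedge product with \<eta> on \<open>Lam21\<close> and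
    its negative on \<open>Lam23\<close>. Evaluation at (X, \<xi>, Z) adds another sign, so K is
    matched by \<open>hodge (- k1)\<close> and \<open>hodge k3\<close>.\<close>
  have "- k1 = (\<lambda>X Y. (- c) * Phi0 X Y)" by (simp add: c fun_eq_iff)
  then have k1: "- k1 \<in> Lam21" unfolding Lam21_def by blast
  have k2: "k2 \<in> alt2" using k(2) by (simp add: Lam22_def)
  have W: "pr_W (theta1 t) \<in> W2" "pr_W (hodge (- k1)) \<in> W3" "pr_W (hodge k3) \<in> W5" "theta3 k2 \<in> W7"
    using t k(2,3) k1
    by (simp_all add: W2_def W3_def W5_def W7_def Lam31_def Lam33_def image_image theta2_hodge)
  \<comment> \<open>On horizontal triples only \<open>theta1 t\<close> and the mixed tensor
    contribute, so u and v are read off after subtracting the former. The values with \<xi> in the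
    first slot belong to \<open>theta3 k2\<close>.\<close>
  define B where "B = pr_W S - pr_W (theta1 t)"
  define u where "u = (\<chi> i. if i = 5 then 0 else B (bvec i) (bvec 1) (bvec 3))"
  define v where "v = (\<chi> i. if i = 5 then 0 else B (bvec i) (bvec 1) (bvec 4))"
  have M: "mixed_tensor u v \<in> W6 + W9" by (rule mixed_tensor_mem) (simp_all add: u_def v_def)
  note k_bvec = k(2)[unfolded Lam22_iff] k(3)[unfolded Lam23_iff] k(4)[unfolded Lam24_iff]
  have K_bvec: "(s (bvec i) (bvec j) - s (bvec j) (bvec i)) / 2 =
      k1 (bvec i) (bvec j) + k2 (bvec i) (bvec j) + k3 (bvec i) (bvec j) + k4 (bvec i) (bvec j)"
    if "i < j" for i j
    using form2_of_bvec[OF that, of "\<lambda>i j. (s (bvec i) (bvec j) - s (bvec j) (bvec i)) / 2"]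
    unfolding K_def[symmetric] K by simp
  \<comment> \<open>By cyclicity S(\<xi>, ., .) is 2K on horizontal vectors, and k4 drops out there.
    The first rule is oriented to leave only S(i, \<xi>, j) with i < j.\<close>
  have S5: "?S j 5 i = ?S i 5 j - 2 * (c * Phi0 (bvec i) (bvec j) + k2 (bvec i) (bvec j) + k3 (bvec i) (bvec j))"
      "?S 5 i j = 2 * (c * Phi0 (bvec i) (bvec j) + k2 (bvec i) (bvec j) + k3 (bvec i) (bvec j))"
    if "i \<noteq> 5" "i < j" for i j
  proof -
    have "j \<noteq> 5" using that exhaust_5[of i] less_5 by (auto dest: less_not_sym)
    moreover have "k4 (bvec i) (bvec j) = 0"
      using that \<open>j \<noteq> 5\<close> k_bvec(3) exhaust_5[of i] exhaust_5[of j] less_5 by (auto dest: less_not_sym)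
    ultimately show *: "?S j 5 i = ?S i 5 j - 2 * (c * Phi0 (bvec i) (bvec j) + k2 (bvec i) (bvec j) + k3 (bvec i) (bvec j))"
      using K_bvec[OF that(2)] that(1) by (simp add: s_bvec c field_simps)
    show "?S 5 i j = 2 * (c * Phi0 (bvec i) (bvec j) + k2 (bvec i) (bvec j) + k3 (bvec i) (bvec j))"
      using cyc[of xi0 "bvec i" "bvec j"] * Aspace_skew[OF S, of "bvec i" "bvec j" xi0] by simp
  qed
  have "pr_W S = pr_W (theta1 t) + pr_W (hodge (- k1)) + pr_W (hodge k3) + theta3 k2 + mixed_tensor u v + sym_tensor h"
  proof (rule Aspace_eqI)
    show "pr_W S \<in> Aspace" by (rule pr_W_in_Aspace[OF S])
    show "pr_W (theta1 t) + pr_W (hodge (- k1)) + pr_W (hodge k3) + theta3 k2 + mixed_tensor u v + sym_tensor h \<in> Aspace"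
      by (intro Aspace_add pr_W_in_Aspace T hodge_in_Aspace theta3_in_Aspace k2 mixed_tensor_in_Aspace
          sym_tensor_in_Aspace hb)
  qed (simp_all add: forall_5 pr_W_bvec[OF S] pr_W_bvec[OF T] pr_W_bvec[OF hodge_in_Aspace]
      theta1_def theta3_eq[OF k2] mixed_tensor_def sym_tensor_def h_def s_bvec u_def v_def B_def t_bvec c
      S5 Phi0_eq hodge_bvec alt3_bvec_sort[OF hodge_in_alt3] alt3_diag[OF hodge_in_alt3] inner_axis inner_axis_axis
      bvec_nth k_bvec alt2D[OF k2] alt2_bvec_sort[OF k2] Aspace_simps[OF S] Aspace_sort[OF S] less_5 field_simps)
  moreover obtain w6 w9 where "w6 \<in> W6" "w9 \<in> W9" "mixed_tensor u v = w6 + w9"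
    using M by (rule set_plus_elim)
  moreover obtain w8 w10 where "w8 \<in> W8" "w10 \<in> W10" "sym_tensor h = w8 + w10"
    using h by (rule set_plus_elim)
  ultimately have "pr_W S = pr_W (theta1 t) + pr_W (hodge (- k1)) + pr_W (hodge k3) + w6 + theta3 k2 + w8 + w9 + w10"
    by (simp add: ac_simps)
  then show ?thesis
    using W \<open>w6 \<in> W6\<close> \<open>w9 \<in> W9\<close> \<open>w8 \<in> W8\<close> \<open>w10 \<in> W10\<close> by (auto intro!: set_plus_intro)
qed

section \<open>Frames and connections\<close>

lemma Ck_on_const: "Ck_on k S (\<lambda>_. c)"
  by (induction k arbitrary: c) simp_all

lemma smooth_near_const: "open_in M U \<Longrightarrow> p \<in> U \<Longrightarrow> smooth_near M p (\<lambda>_. c)"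
  unfolding smooth_near_def smooth_fun_def smooth_on_def
  by (intro exI[of _ U]) (auto simp: comp_def Ck_on_const)

lemma tangent_spaceD:
  assumes "v \<in> tangent_space M p"
  shows "smooth_near M p f \<Longrightarrow> smooth_near M p h \<Longrightarrow> v (\<lambda>q. a * f q + b * h q) = a * v f + b * v h"
    "smooth_near M p f \<Longrightarrow> smooth_near M p h \<Longrightarrow> v (\<lambda>q. f q * h q) = f p * v h + h p * v f"
    "smooth_near M p f \<Longrightarrow> open_in M U \<Longrightarrow> p \<in> U \<Longrightarrow> (\<And>q. q \<in> U \<Longrightarrow> f q = h q) \<Longrightarrow> v f = v h"
    "\<not> smooth_near M p f \<Longrightarrow> v f = 0"
proof -
  note v = assms[unfolded tangent_space_def mem_Collect_eq]
  show "v (\<lambda>q. a * f q + b * h q) = a * v f + b * v h" if "smooth_near M p f" "smooth_near M p h"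
    using v[THEN conjunct1, rule_format, of f h a b] that by simp
  show "v (\<lambda>q. f q * h q) = f p * v h + h p * v f" if "smooth_near M p f" "smooth_near M p h"
    using v[THEN conjunct2, THEN conjunct1, rule_format, of f h] that by simp
  show "v f = v h" if "smooth_near M p f" "open_in M U" "p \<in> U" "\<And>q. q \<in> U \<Longrightarrow> f q = h q"
    using v[THEN conjunct2, THEN conjunct2, THEN conjunct1, rule_format, of f U h] that by simp
  show "v f = 0" if "\<not> smooth_near M p f"
    using v[THEN conjunct2, THEN conjunct2, THEN conjunct2, rule_format, of f] that by simp
qed

lemma tangent_vector_const:
  assumes v: "v \<in> tangent_space M p" and U: "open_in M U" "p \<in> U"
  shows "v (\<lambda>_. c) = 0"
proof -
  note const = smooth_near_const[OF U]
  show ?thesis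
    \<comment> \<open>The Leibniz rule for 1 times 1 gives v(1) = 2 v(1); linearity then covers
      every constant.\<close>
    using tangent_spaceD(2)[OF v const const, of 1 1] tangent_spaceD(1)[OF v const const, of c 1 0 1]
    by simp
qed

lemma tangent_vector_locally_const:
  assumes v: "v \<in> tangent_space M p" and U: "open_in M U" "p \<in> U" and f: "\<And>q. q \<in> U \<Longrightarrow> f q = c"
  shows "v f = 0"
proof -
  have "v (\<lambda>_. c) = v f"
    using f by (intro tangent_spaceD(3)[OF v smooth_near_const[OF U] U]) simp
  then show ?thesis using tangent_vector_const[OF v U] by simp
qed

lemma tangent_space_combo:
  assumes "u \<in> tangent_space M p" "v \<in> tangent_space M p"
  shows "tscale a u + tscale b v \<in> tangent_space M p"
proof -
  note D = tangent_spaceD[OF assms(1)] tangent_spaceD[OF assms(2)]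
  show ?thesis
    unfolding tangent_space_def mem_Collect_eq
  proof (intro conjI allI impI; (elim conjE)?)
    fix f h :: "'a \<Rightarrow> real" and c d
    assume "smooth_near M p f" "smooth_near M p h"
    then show "(tscale a u + tscale b v) (\<lambda>q. c * f q + d * h q) =
        c * (tscale a u + tscale b v) f + d * (tscale a u + tscale b v) h"
      "(tscale a u + tscale b v) (\<lambda>q. f q * h q) =
        f p * (tscale a u + tscale b v) h + h p * (tscale a u + tscale b v) f"
      by (simp_all add: tscale_def D(1,2,5,6) algebra_simps)
  next
    fix f h U
    assume "smooth_near M p f" "open_in M U" "p \<in> U" "\<forall>q\<in>U. f q = h q"
    then show "(tscale a u + tscale b v) f = (tscale a u + tscale b v) h"
      using D(3)[of f U h] D(7)[of f U h] by (simp add: tscale_def)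
  next
    fix f
    assume "\<not> smooth_near M p f"
    then show "(tscale a u + tscale b v) f = 0"
      by (simp add: tscale_def D(4,8))
  qed
qed

lemma diff_tscale: "u - v = tscale 1 u + tscale (- 1) v"
  by (simp add: tscale_def fun_eq_iff)

lemma tangent_space_diff:
  "u \<in> tangent_space M p \<Longrightarrow> v \<in> tangent_space M p \<Longrightarrow> u - v \<in> tangent_space M p"
  unfolding diff_tscale by (rule tangent_space_combo)

text \<open>F is linear only on tangent vectors, so the induction carries membership in the tangent
  space along.\<close>

lemma frame_vector_linear:
  assumes E: "\<And>k. E k p \<in> tangent_space M p"
    and F: "\<And>u v a b. u \<in> tangent_space M p \<Longrightarrow> v \<in> tangent_space M p \<Longrightarrow>
      F (tscale a u + tscale b v) = a * F u + b * F v"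
  shows "F (frame_vector E p X) = (\<Sum>k\<in>UNIV. X $ k * F (E k p))"
proof -
  have "(\<Sum>k\<in>I. tscale (X $ k) (E k p)) \<in> tangent_space M p \<and>
      F (\<Sum>k\<in>I. tscale (X $ k) (E k p)) = (\<Sum>k\<in>I. X $ k * F (E k p))" if "finite I" for I
    using that
  proof induction
    case empty
    \<comment> \<open>The zero vector is written as a combination of the form to which the linearity
      of F applies.\<close>
    have z: "tscale 0 (E 1 p) + tscale 0 (E 1 p) = 0" by (simp add: tscale_def fun_eq_iff)
    have "F 0 = 0" using F[OF E E, of 0 1 0 1] unfolding z by simp
    with tangent_space_combo[OF E E, of 0 1 0 1] show ?case unfolding z sum.empty by (rule conjI)
  next
    case (insert k I)
    note T = insert.IH[THEN conjunct1] and FI = insert.IH[THEN conjunct2]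
    have eq: "(\<Sum>k\<in>insert k I. tscale (X $ k) (E k p)) =
        tscale (X $ k) (E k p) + tscale 1 (\<Sum>k\<in>I. tscale (X $ k) (E k p))"
      unfolding sum.insert[OF insert.hyps] by (simp add: tscale_def)
    show ?case
      unfolding eq F[OF E T] FI sum.insert[OF insert.hyps] mult_1
      by (rule conjI[OF tangent_space_combo[OF E T] refl])
  qed
  from this[THEN conjunct2, OF finite] show ?thesis unfolding frame_vector_def .
qed

lemma riemannian_metricD:
  assumes "riemannian_metric M g" "p \<in> points M"
    and u: "u \<in> tangent_space M p" and v: "v \<in> tangent_space M p" and w: "w \<in> tangent_space M p"
  shows "g p (tscale a u + tscale b v) w = a * g p u w + b * g p v w"
    "g p (u - v) w = g p u w - g p v w" "g p w (u - v) = g p w u - g p w v"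
    "g p u v = g p v u" "g p 0 w = 0" "g p u u = 0 \<Longrightarrow> u = 0"
proof -
  note g = assms(1)[unfolded riemannian_metric_def]
  have lin: "g p (tscale a u + tscale b v) w = a * g p u w + b * g p v w"
    if "u \<in> tangent_space M p" "v \<in> tangent_space M p" "w \<in> tangent_space M p" for a b u v w
    using that by (rule g[THEN conjunct1, rule_format, OF assms(2)])
  have sym: "g p u v = g p v u" if "u \<in> tangent_space M p" "v \<in> tangent_space M p" for u v
    using that by (rule g[THEN conjunct2, THEN conjunct1, rule_format, OF assms(2)])
  show "g p (tscale a u + tscale b v) w = a * g p u w + b * g p v w" by (rule lin[OF u v w])
  show *: "g p (u - v) w = g p u w - g p v w" unfolding diff_tscale by (simp add: lin[OF u v w])
  then show "g p w (u - v) = g p w u - g p w v"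
    using sym[OF w tangent_space_diff[OF u v]] sym[OF w u] sym[OF w v] by simp
  show "g p u v = g p v u" by (rule sym[OF u v])
  have "0 = tscale 0 u + tscale 0 v" by (simp add: tscale_def fun_eq_iff)
  with lin[OF u v w, of 0 0] show "g p 0 w = 0" by simp
  show "u = 0" if "g p u u = 0"
  proof (rule ccontr)
    assume "u \<noteq> 0"
    then have "g p u u > 0"
      by (rule g[THEN conjunct2, THEN conjunct2, THEN conjunct1, rule_format, OF assms(2) u])
    with that show False by simp
  qed
qed

section \<open>Connection forms in an orthonormal frame\<close>

lemma Omega_form2_of: "Omega g D E p X = form2_of (\<lambda>i j. conn_form g D E p i j X)"
  by (intro ext) (simp add: Omega_def form2_of_def)

lemma frame_fields:
  assumes "open_in M U" "p \<in> U" "orthonormal_frame M g U E"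
  shows "E i p \<in> tangent_space M p" "field_near M p (E i)"
  using assms unfolding orthonormal_frame_def smooth_field_def field_near_def by blast+

lemma connectionD:
  assumes "connection M D" "p \<in> points M" "field_near M p Y"
  shows "v \<in> tangent_space M p \<Longrightarrow> D p v Y \<in> tangent_space M p"
    "u \<in> tangent_space M p \<Longrightarrow> v \<in> tangent_space M p \<Longrightarrow>
      D p (tscale a u + tscale b v) Y = tscale a (D p u Y) + tscale b (D p v Y)"
    "v \<in> tangent_space M p \<Longrightarrow> open_in M U \<Longrightarrow> p \<in> U \<Longrightarrow> (\<And>q. q \<in> U \<Longrightarrow> Y q = Z q) \<Longrightarrow> D p v Y = D p v Z"
proof -
  note D = assms(1)[unfolded connection_def]
  show "D p v Y \<in> tangent_space M p" if "v \<in> tangent_space M p"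
    by (rule D[THEN conjunct1, rule_format, OF assms(2) that assms(3)])
  show "D p (tscale a u + tscale b v) Y = tscale a (D p u Y) + tscale b (D p v Y)"
    if "u \<in> tangent_space M p" "v \<in> tangent_space M p"
    by (rule D[THEN conjunct2, THEN conjunct1, rule_format, OF assms(2) that assms(3)])
  show "D p v Y = D p v Z"
    if "v \<in> tangent_space M p" "open_in M U" "p \<in> U" "\<And>q. q \<in> U \<Longrightarrow> Y q = Z q"
    using that assms(3)
    by (intro D[THEN conjunct2, THEN conjunct2, THEN conjunct2, THEN conjunct2, THEN conjunct1,
          rule_format, OF assms(2)]) blast+
qed

lemma conn_form_eq:
  assumes g: "riemannian_metric M g" and D: "connection M D"
    and U: "open_in M U" "p \<in> U" "orthonormal_frame M g U E"
  shows "conn_form g D E p i j X = (\<Sum>k\<in>UNIV. X $ k * g p (D p (E k p) (E i)) (E j p))"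
proof -
  note E = frame_fields[OF U]
  have p: "p \<in> points M" using U by (auto simp: open_in_def)
  note DT = connectionD(1)[OF D p E(2)]
  show ?thesis
    unfolding conn_form_def
    by (rule frame_vector_linear[where F = "\<lambda>v. g p (D p v (E i)) (E j p)" and E = E and p = p, OF E(1)])
       (simp add: connectionD(2)[OF D p E(2)] riemannian_metricD(1)[OF g p DT DT E(1)])
qed

lemma Omega_in_Aspace:
  assumes "riemannian_metric M g" "connection M D" "open_in M U" "p \<in> U" "orthonormal_frame M g U E"
  shows "Omega g D E p \<in> Aspace"
proof (rule AspaceI)
  have "conn_form g D E p i j (X + X') = conn_form g D E p i j X + conn_form g D E p i j X'"
    "conn_form g D E p i j (a *\<^sub>R X) = a * conn_form g D E p i j X" for i j X X' a
    unfolding conn_form_eq[OF assms] by (simp_all add: distrib_right sum.distrib sum_distrib_left mult.assoc)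
  then show "Omega g D E p (X + X') Y Z = Omega g D E p X Y Z + Omega g D E p X' Y Z"
    "Omega g D E p (a *\<^sub>R X) Y Z = a * Omega g D E p X Y Z" for X X' Y Z a
    by (simp_all add: Omega_def distrib_right sum.distrib sum_distrib_left mult.assoc case_prod_unfold)
  show "Omega g D E p X \<in> alt2" for X by (simp add: Omega_form2_of form2_of_in_alt2)
qed

text \<open>Differentiate the locally constant function g(E i, E j).\<close>

lemma frame_connection_skew:
  assumes g: "riemannian_metric M g" and D: "metric_connection M g D"
    and U: "open_in M U" "p \<in> U" "orthonormal_frame M g U E"
  shows "g p (D p (E k p) (E i)) (E j p) = - g p (D p (E k p) (E j)) (E i p)"
proof -
  note E = frame_fields[OF U]
  have p: "p \<in> points M" using U by (auto simp: open_in_def)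
  have DT: "D p (E k p) (E i) \<in> tangent_space M p" for i
    using D by (intro connectionD(1)[OF _ p E(2) E(1)]) (simp add: metric_connection_def)
  have "E k p (\<lambda>q. g q (E i q) (E j q)) = g p (D p (E k p) (E i)) (E j p) + g p (E i p) (D p (E k p) (E j))"
    by (rule D[unfolded metric_connection_def, THEN conjunct2, rule_format, OF p E(1) conjI[OF E(2) E(2)]])
  moreover have "E k p (\<lambda>q. g q (E i q) (E j q)) = 0"
    using U(3) by (intro tangent_vector_locally_const[OF E(1) U(1,2), of _ "if i = j then 1 else 0"])
      (auto simp: orthonormal_frame_def)
  ultimately show ?thesis
    using riemannian_metricD(4)[OF g p DT E(1) E(1)] by simp
qed

text \<open>\<open>Omega\<close> reads only i < j; skew-symmetry of both sides gives the other
  pairs.\<close>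

lemma Omega_bvec:
  assumes g: "riemannian_metric M g" and D: "metric_connection M g D"
    and U: "open_in M U" "p \<in> U" "orthonormal_frame M g U E"
  shows "Omega g D E p (bvec k) (bvec i) (bvec j) = g p (D p (E k p) (E i)) (E j p)"
proof -
  have c: "connection M D" using D by (simp add: metric_connection_def)
  have lt: "Omega g D E p (bvec k) (bvec i) (bvec j) = g p (D p (E k p) (E i)) (E j p)" if "i < j" for i j
    using that by (simp add: Omega_form2_of form2_of_bvec conn_form_eq[OF g c U] bvec_nth mult_if_delta)
  note skew = Aspace_skew[OF Omega_in_Aspace[OF g c U], of "bvec k" "bvec i" "bvec j"]
    frame_connection_skew[OF g D U, of k i j]
  consider "i < j" | "j < i" | "i = j" by (rule linorder_cases)
  then show ?thesis
  proof cases
    case 1 then show ?thesis by (rule lt)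
  next
    case 2 then show ?thesis using lt[OF 2] skew by simp
  next
    case 3 then show ?thesis using skew by simp
  qed
qed

text \<open>The Levi-Civita connection has no torsion, so subtracting its torsion eliminates the Lie
  bracket.\<close>

lemma torsion_frame:
  assumes g: "riemannian_metric M g" and Dg: "levi_civita M g Dg" and D: "metric_connection M g D"
    and U: "open_in M U" "p \<in> U" "orthonormal_frame M g U E"
  defines "S \<equiv> Omega g Dg E p - Omega g D E p"
  shows "torsion M g D p (E i) (E j) (E k) =
    S (bvec j) (bvec i) (bvec k) - S (bvec i) (bvec j) (bvec k)"
proof -
  note E = frame_fields[OF U]
  have p: "p \<in> points M" using U by (auto simp: open_in_def)
  have mg: "metric_connection M g Dg" using Dg by (simp add: levi_civita_def)
  have T: "D' p (E i p) (E j) \<in> tangent_space M p" if "metric_connection M g D'" for D' i j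
    using that by (intro connectionD(1)[OF _ p E(2) E(1)]) (simp add: metric_connection_def)
  have "torsion_vector M Dg p (E i) (E j) = 0"
    by (rule Dg[unfolded levi_civita_def, THEN conjunct2, rule_format, OF p conjI[OF E(2) E(2)]])
  then have "torsion_vector M D p (E i) (E j) = (D p (E i p) (E j) - D p (E j p) (E i)) -
      (Dg p (E i p) (E j) - Dg p (E j p) (E i))"
    unfolding torsion_vector_def by (simp add: algebra_simps)
  then show ?thesis
    by (simp add: torsion_def S_def Omega_bvec[OF g D U] Omega_bvec[OF g mg U]
      riemannian_metricD(2)[OF g p _ _ E(1)] T[OF D] T[OF mg] tangent_space_diff)
qed

text \<open>The components with index 5 vanish since \<xi> is parallel. Parallelism of \<phi>,
  applied to E 1 = \<phi>(E 2), gives the two relations between the 13, 24 and the 14, 23 components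
  that \<open>pr_W_bvec\<close> calls for.\<close>

lemma pr_W_compatible:
  assumes g: "riemannian_metric M g" and D: "metric_connection M g D"
    and \<phi>: "endomorphism_field M \<phi>" and comp: "compatible M \<xi> \<eta> \<phi> D"
    and U: "open_in M U" "p \<in> U" and E: "adapted_frame M g \<xi> \<phi> U E"
  shows "pr_W (Omega g D E p) = 0"
proof -
  have o: "orthonormal_frame M g U E" using E by (simp add: adapted_frame_def)
  have c: "connection M D" using D by (simp add: metric_connection_def)
  have p: "p \<in> points M" using U by (auto simp: open_in_def)
  note UE = frame_fields[OF U o]
  have on: "g q (E i q) (E j q) = (if i = j then 1 else 0)" if "q \<in> U" for q i j
    using o that by (simp add: orthonormal_frame_def)
  have loc: "D p v Y = D p v Z"
    if "v \<in> tangent_space M p" "field_near M p Y" "\<And>q. q \<in> U \<Longrightarrow> Y q = Z q" for v Y Z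
    using connectionD(3)[OF c p that(2,1) U that(3)] .
  have ff: "g q u (\<phi> q v) = wedge11 (g q (E 1 q)) (g q (E 2 q)) u v + wedge11 (g q (E 3 q)) (g q (E 4 q)) u v"
    if "q \<in> U" "u \<in> tangent_space M q" "v \<in> tangent_space M q" for q u v
    using E that by (simp add: adapted_frame_def fundamental_form_def)
  have D5: "D p (E k p) (E 5) = 0" for k
    using loc[OF UE(1) UE(2), of 5 \<xi> k] E comp p UE(1)[of k]
    by (simp add: adapted_frame_def compatible_def)
  \<comment> \<open>The frame only prescribes the components of the fundamental form; they show that
    E 1 - \<phi>(E 2) has norm 0.\<close>
  have E1: "E 1 q = \<phi> q (E 2 q)" if q: "q \<in> U" for q
  proof -
    note T = frame_fields(1)[OF U(1) q o]
    have pq: "q \<in> points M" using U(1) q by (auto simp: open_in_def)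
    have pT: "\<phi> q (E 2 q) \<in> tangent_space M q"
      by (rule \<phi>[unfolded endomorphism_field_def, THEN conjunct1, rule_format, OF pq T])
    let ?w = "E 1 q - \<phi> q (E 2 q)"
    have w: "?w \<in> tangent_space M q" by (rule tangent_space_diff[OF T pT])
    have "g q ?w (\<phi> q (E 2 q)) = g q (E 1 q) ?w"
      by (simp add: ff[OF q w T] wedge11_def on[OF q])
    then have "g q ?w ?w = 0"
      using riemannian_metricD(3)[OF g pq T pT w] riemannian_metricD(4)[OF g pq w T T] by simp
    then have "?w = 0" by (rule riemannian_metricD(6)[OF g pq w w w])
    then show ?thesis by simp
  qed
  have D1: "D p (E k p) (E 1) = \<phi> p (D p (E k p) (E 2))" for k
    using loc[OF UE(1) UE(2), of 1 "\<lambda>q. \<phi> q (E 2 q)" k] E1 comp p UE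
    by (simp add: compatible_def)
  have DT: "D p (E k p) (E i) \<in> tangent_space M p" for k i
    by (rule connectionD(1)[OF c p UE(2) UE(1)])
  have D1E: "g p (D p (E k p) (E 1)) (E j p) = g p (E j p) (\<phi> p (D p (E k p) (E 2)))" for j k
    unfolding D1[symmetric] by (rule riemannian_metricD(4)[OF g p DT UE(1) UE(1)])
  have flip: "g p (E j p) (D p (E k p) (E 2)) = g p (D p (E k p) (E 2)) (E j p)" for j k
    by (rule riemannian_metricD(4)[OF g p UE(1) DT UE(1)])
  note O = Omega_in_Aspace[OF g c U o]
  have z: "0 \<in> Aspace" by (intro AspaceI alt2I) simp_all
  show ?thesis
    by (rule Aspace_eqI)
      (simp_all add: pr_W_in_Aspace[OF O] z pr_W_bvec[OF O] Omega_bvec[OF g D U o] D5 D1E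
        ff[OF U(2) UE(1) DT] wedge11_def on[OF U(2)] flip riemannian_metricD(5)[OF g p UE(1) UE(1) UE(1)])
qed

section \<open>From frame components to the class of the manifold\<close>

lemma alt3_if_bvec:
  assumes S: "S \<in> Aspace" and "\<And>i j k. S (bvec i) (bvec j) (bvec k) + S (bvec j) (bvec i) (bvec k) = 0"
  shows "S \<in> alt3"
proof -
  have "trilinear (\<lambda>X Y Z. S X Y Z + S Y X Z)"
    by (simp add: trilinear_iff Aspace_simps[OF S] algebra_simps)
  then have "(\<lambda>X Y Z. S X Y Z + S Y X Z) = (\<lambda>X Y Z. 0)"
    using assms(2) by (intro trilinear_eqI) (simp_all add: trilinear_iff)
  then show ?thesis using S by (simp add: alt3_def fun_eq_iff)
qed

lemma A3_if_bvec:
  assumes S: "S \<in> Aspace"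
    and "\<And>i j k. S (bvec i) (bvec j) (bvec k) + S (bvec j) (bvec k) (bvec i) + S (bvec k) (bvec i) (bvec j) = 0"
    and "\<And>k. (\<Sum>i\<in>UNIV. S (bvec i) (bvec i) (bvec k)) = 0"
  shows "S \<in> A3"
proof -
  have "trilinear (\<lambda>X Y Z. S X Y Z + S Y Z X + S Z X Y)"
    by (simp add: trilinear_iff Aspace_simps[OF S] algebra_simps)
  then have "(\<lambda>X Y Z. S X Y Z + S Y Z X + S Z X Y) = (\<lambda>X Y Z. 0)"
    using assms(2) by (intro trilinear_eqI) (simp_all add: trilinear_iff)
  moreover have "(\<lambda>X. \<Sum>i\<in>UNIV. S (bvec i) (bvec i) X) = (\<lambda>X. 0)"
    using assms(3) by (intro linear_eq_bvec) (simp_all add: linear_iff Aspace_simps[OF S] sum_5 algebra_simps)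
  ultimately show ?thesis using S by (simp add: A3_def fun_eq_iff)
qed

theorem proposition4p1:
  fixes M :: "'a::{t2_space, second_countable_topology} chart set"
    and g :: "'a metric_field"
    and \<xi> :: "'a field"
    and \<eta> :: "'a \<Rightarrow> 'a tvec \<Rightarrow> real"
    and \<phi> :: "'a \<Rightarrow> 'a tvec \<Rightarrow> 'a tvec"
    and Dg Dc :: "'a conn"
  assumes "almost_contact_metric M g \<xi> \<eta> \<phi>"
    and "levi_civita M g Dg"
    and "metric_connection M g Dc"
    and "compatible M \<xi> \<eta> \<phi> Dc"
  shows "(vectorial_torsion M g Dc \<longrightarrow>
            of_class M g \<xi> \<phi> Dg (W1 + W2)) \<and>
         (skew_torsion M g Dc \<longrightarrow>
            of_class M g \<xi> \<phi> Dg (W3 + W4 + W5 + W6)) \<and>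
         (traceless_cyclic_torsion M g Dc \<longrightarrow>
            of_class M g \<xi> \<phi> Dg (W2 + W3 + W5 + W6 + W7 + W8 + W9 + W10))"
proof -
  have g: "riemannian_metric M g" and \<phi>: "endomorphism_field M \<phi>"
    using assms(1) unfolding almost_contact_metric_def by blast+
  define S where "S E p = Omega g Dg E p - Omega g Dc E p" for E p
  define T where "T E p i j k = torsion M g Dc p (E i) (E j) (E k)" for E :: "5 \<Rightarrow> 'a field" and p i j k
  let ?S = "\<lambda>E p i j k. S E p (bvec i) (bvec j) (bvec k)"
  let ?frame = "\<lambda>p U E. p \<in> points M \<and> open_in M U \<and> p \<in> U \<and> adapted_frame M g \<xi> \<phi> U E"
  have frame: "S E p \<in> Aspace" "intrinsic_torsion g Dg E p = pr_W (S E p)"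
      "T E p i j k = ?S E p j i k - ?S E p i j k"
    if "?frame p U E" for p U E i j k
  proof -
    have U: "open_in M U" "p \<in> U" and a: "adapted_frame M g \<xi> \<phi> U E" using that by blast+
    have o: "orthonormal_frame M g U E" using a by (simp add: adapted_frame_def)
    have "connection M Dg" "connection M Dc"
      using assms(2,3) by (simp_all add: levi_civita_def metric_connection_def)
    note OA = this[THEN Omega_in_Aspace[OF g _ U o]]
    show S: "S E p \<in> Aspace" unfolding S_def using OA by (rule Aspace_diff)
    have "Omega g Dg E p = S E p + Omega g Dc E p" by (simp add: S_def)
    then show "intrinsic_torsion g Dg E p = pr_W (S E p)"
      using pr_W_compatible[OF g assms(3) \<phi> assms(4) U a]
      by (simp add: intrinsic_torsion_def pr_W_add[OF S OA(2)])
    show "T E p i j k = ?S E p j i k - ?S E p i j k"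
      unfolding T_def S_def by (rule torsion_frame[OF g assms(2,3) U o])
  qed
  \<comment> \<open>Inserting \<open>frame(3)\<close> on the right, all terms except S(i, j, k)
    cancel by skew-symmetry in the last two slots.\<close>
  have koszul: "2 * ?S E p i j k = T E p j k i - T E p i j k - T E p k i j" if "?frame p U E" for p U E i j k
    using Aspace_skew[OF frame(1)[OF that], of "bvec i" "bvec k" "bvec j"]
      Aspace_skew[OF frame(1)[OF that], of "bvec j" "bvec k" "bvec i"]
      Aspace_skew[OF frame(1)[OF that], of "bvec k" "bvec i" "bvec j"]
    by (simp add: frame(3)[OF that])
  have near: "field_near M p (E i)" if "?frame p U E" for p U E i
    using that frame_fields(2) unfolding adapted_frame_def by blast
  have "pr_W (S E p) \<in> W1 + W2" if v: "vectorial_torsion M g Dc" and f: "?frame p U E" for p U E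
  proof -
    obtain \<alpha> where "T E p i j k = \<alpha> p (E i p) * g p (E j p) (E k p) - \<alpha> p (E j p) * g p (E i p) (E k p)" for i j k
      using v f near[OF f] unfolding vectorial_torsion_def T_def by blast
    then have T: "T E p i j k = \<alpha> p (E i p) * (if j = k then 1 else 0) - \<alpha> p (E j p) * (if i = k then 1 else 0)" for i j k
      using f by (simp add: adapted_frame_def orthonormal_frame_def)
    \<comment> \<open>The Koszul formula gives S(i, j, k) = \<alpha>(j) [i = k] - \<alpha>(k)
      [i = j], which fixes the sign of a.\<close>
    define a :: vec5 where "a = (\<chi> k. - \<alpha> p (E k p))"
    have a: "flat a \<in> alt1" by (simp add: alt1_def linear_flat)
    have "S E p = theta1 (flat a)"
    proof (rule trilinear_eqI)
      show "trilinear (S E p)" "trilinear (theta1 (flat a))"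
        using frame(1)[OF f] theta1_in_Aspace[OF a] by (simp_all add: Aspace_iff)
      show "?S E p i j k = theta1 (flat a) (bvec i) (bvec j) (bvec k)" for i j k
        using koszul[OF f, of i j k] unfolding T by (auto simp: theta1_def a_def inner_axis inner_axis_axis bvec_nth)
    qed
    then show ?thesis using pr_W_theta1[OF a] by simp
  qed
  moreover have "pr_W (S E p) \<in> W3 + W4 + W5 + W6" if s: "skew_torsion M g Dc" and f: "?frame p U E" for p U E
  proof (intro pr_W_alt3 alt3_if_bvec frame(1)[OF f])
    have T: "T E p i j k + T E p i k j = 0" for i j k
      using s f near[OF f] unfolding skew_torsion_def T_def by blast
    show "?S E p i j k + ?S E p j i k = 0" for i j k
    proof -
      \<comment> \<open>Torsion is always skew in its first two arguments; with the hypothesis it is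
        a 3-form and S is -T/2.\<close>
      have "T E p i j k + T E p j i k = 0" by (simp add: frame(3)[OF f])
      then show ?thesis
        using koszul[OF f, of i j k] koszul[OF f, of j i k] T[of i j k] T[of j k i] T[of k i j]
        by linarith
    qed
  qed
  moreover have "pr_W (S E p) \<in> W2 + W3 + W5 + W6 + W7 + W8 + W9 + W10"
    if t: "traceless_cyclic_torsion M g Dc" and f: "?frame p U E" for p U E
  proof (intro pr_W_A3 A3_if_bvec frame(1)[OF f])
    have cyc: "T E p i j k + T E p j k i + T E p k i j = 0" for i j k
      using t f near[OF f] unfolding traceless_cyclic_torsion_def T_def by blast
    have tr: "(\<Sum>i\<in>UNIV. T E p k i i) = 0" for k
      using t f near[OF f] unfolding traceless_cyclic_torsion_def T_def adapted_frame_def by blast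
    \<comment> \<open>The cyclic identity replaces the last two terms of the Koszul formula by
      another T(j, k, i), so S is a cyclic shift of T.\<close>
    have S: "?S E p i j k = T E p j k i" for i j k
      using koszul[OF f, of i j k] cyc[of i j k] by simp
    show "?S E p i j k + ?S E p j k i + ?S E p k i j = 0" for i j k
      unfolding S using cyc[of i j k] by simp
    have "T E p i k i = - T E p k i i" for i k by (simp add: frame(3)[OF f])
    then show "(\<Sum>i\<in>UNIV. ?S E p i i k) = 0" for k
      using tr[of k] by (simp add: S sum_negf)
  qed
  ultimately show ?thesis
    unfolding of_class_def using frame(2) by auto
qed

end
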